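(* Let $d=2$ and let $\mathcal D\subseteq\mathbb S_1^1$ be a half-open interval (arc) of arclength $\tau>\pi$. Then for any unimodular lattice $\mathcal L\subset\mathbb R^2$, $\vec\alpha\in\mathbb R^2$ and $N\in\mathbb N$, $$g_N(\mathcal D,\vec\alpha,\mathcal L)\le\begin{cases}5 & \text{if } \tau=2\pi,\\ 9 & \text{if } 5\pi/3<\tau<2\pi,\\ 8 & \text{if } \tau=5\pi/3,\\ 9 & \text{if } 4\pi/3<\tau<5\pi/3,\\ 8 & \text{if } \tau=4\pi/3,\\ 12+2\left\lfloor\frac{\sin(\tau/2+\pi/6)}{\sin(\tau-\pi)}\right\rfloor & \text{if } \pi<\tau<4\pi/3.\end{cases}$$
   Context: $\mathbb S_1^{d-1}$ is the unit sphere in $\mathbb R^d$ (here the unit circle). A unimodular lattice is a lattice of covolume $1$. For $\vec\alpha\in\mathbb R^d$, a unimodular lattice $\mathcal L$, a set $\mathcal D\subseteq\mathbb S_1^{d-1}$ and $1\le n\le N$, define the distance to the nearest neighbour in direction $\mathcal D$ by $$\delta_{n,N}(\mathcal D)=\min\{|(m-n)\vec\alpha+\vec\ell| : (m-n)\vec\alpha+\vec\ell\in\mathbb R_{>0}\mathcal D,\ 1\le m\le N,\ \vec\ell\in\mathcal L\}$$ (Euclidean norm), and $g_N(\mathcal D,\vec\alpha,\mathcal L)=|\{\delta_{n,N}(\mathcal D):1\le n\le N\}|$. *)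

theory Defs
  imports "HOL-Analysis.Analysis"
begin

definition vec2 :: "real \<Rightarrow> real \<Rightarrow> real^2" where
  "vec2 x y = (\<chi> i. if i = 1 then x else y)"

definition unit_dir :: "real \<Rightarrow> real^2" where
  "unit_dir t = vec2 (cos t) (sin t)"

definition half_open_arc :: "(real^2) set \<Rightarrow> real \<Rightarrow> bool" where
  "half_open_arc D tau \<longleftrightarrow> 0 < tau \<and> tau \<le> 2 * pi \<and>
     (\<exists>a. D = unit_dir ` {a..<a + tau} \<or> D = unit_dir ` {a<..a + tau})"

definition unimodular_lattice :: "(real^2) set \<Rightarrow> bool" where
  "unimodular_lattice L \<longleftrightarrow> (\<exists>b1 b2::real^2.
     \<bar>b1$1 * b2$2 - b1$2 * b2$1\<bar> = 1 \<and>
     L = {of_int m1 *\<^sub>R b1 + of_int m2 *\<^sub>R b2 | m1 m2. True})"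

definition nn_dist :: "(real^2) set \<Rightarrow> real^2 \<Rightarrow> (real^2) set \<Rightarrow> nat \<Rightarrow> nat \<Rightarrow> real" where
  "nn_dist D \<alpha> L N n = Inf {norm ((real m - real n) *\<^sub>R \<alpha> + l) | m l.
      1 \<le> m \<and> m \<le> N \<and> l \<in> L \<and>
      (\<exists>r>0. \<exists>u\<in>D. (real m - real n) *\<^sub>R \<alpha> + l = r *\<^sub>R u)}"

definition gN :: "nat \<Rightarrow> (real^2) set \<Rightarrow> real^2 \<Rightarrow> (real^2) set \<Rightarrow> nat" where
  "gN N D \<alpha> L = card ((\<lambda>n. nn_dist D \<alpha> L N n) ` {1..N})"

definition gap_bound :: "real \<Rightarrow> int" where
  "gap_bound tau =
    (if tau = 2 * pi then 5
     else if 5 * pi / 3 < tau \<and> tau < 2 * pi then 9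
     else if tau = 5 * pi / 3 then 8
     else if 4 * pi / 3 < tau \<and> tau < 5 * pi / 3 then 9
     else if tau = 4 * pi / 3 then 8
     else 12 + 2 * \<lfloor>sin (tau / 2 + pi / 6) / sin (tau - pi)\<rfloor>)"

end

theory Submission
  imports Defs
begin

text \<open>
  Write \<open>\<delta>\<^sub>n\<close> as the least length of a vector of \<open>t \<alpha> + L\<close> in the cone, where the time \<open>t\<close> runs through
  a window of \<open>N\<close> consecutive integers containing \<open>0\<close>. Let \<open>[-A, J]\<close> be the window with the largest
  value \<open>R\<close>, and by symmetry \<open>J \<le> A\<close>. Any other value is the length of a vector at a time outside
  \<open>[-A, J]\<close>. Vectors at times beyond \<open>A\<close> in absolute value have (up to sign) differences with times in
  \<open>[-J, J]\<close>, so these differences have length at least \<open>R\<close>, pairwise angles exceed \<open>\<pi>/3\<close>, and at most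
  five values arise.

  A vector \<open>e\<close> at a time in \<open>(J, A]\<close> with \<open>|e| < R\<close> cannot have \<open>-e\<close> in the cone, so it lies in a wedge
  of angle \<open>2\<pi> - \<tau> < \<pi>\<close>. If \<open>e'\<close> is a later and shorter vector of this kind, then \<open>z = e' - e\<close> either has
  length at least \<open>R\<close> or lies in the wedge and is not shorter than \<open>e'\<close>; in the latter case the angle
  between \<open>e\<close> and \<open>z\<close> exceeds \<open>2\<pi>/3\<close>. For \<open>\<tau> \<ge> 4\<pi>/3\<close> the wedge is too narrow for that, which leaves
  two such vectors and at most \<open>1 + 5 + 2\<close> values. For \<open>\<tau> < 4\<pi>/3\<close> the vectors admitting such a step lie
  near the two edges of the wedge; along either edge the coordinate in the direction of the axis grows
  while the lengths decay geometrically, which bounds their number.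

  For the full circle the wedge is empty. If five values below \<open>R\<close> existed, then for the shortest
  vector \<open>w\<close> and its angular neighbours \<open>p\<close>, \<open>q\<close> the vector \<open>p + q - w\<close> would be no longer than
  \<open>max |p| |q|\<close> although its time is smaller than those of \<open>p\<close> and \<open>q\<close>.
\<close>

section \<open>Plane geometry\<close>

lemma vec2_nth [simp]: "vec2 x y $ 1 = x" "vec2 x y $ 2 = y"
  by (simp_all add: vec2_def)

lemma unit_dir_inner: "unit_dir s \<bullet> unit_dir t = cos (s - t)"
  by (simp add: unit_dir_def inner_vec_def sum_2 cos_diff)

lemma norm_unit_dir [simp]: "norm (unit_dir t) = 1"
  by (simp add: norm_eq_sqrt_inner unit_dir_inner)

lemma unit_dir_shift:
  "unit_dir (t + pi) = - unit_dir t" "unit_dir (t - pi) = - unit_dir t"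
  by (simp_all add: unit_dir_def vec_eq_iff forall_2)

lemma unit_dir_periodic: "unit_dir (t + 2 * pi * of_int k) = unit_dir t"
  by (simp add: unit_dir_def cos_add sin_add)

text \<open>The start \<open>a\<close> of the angular range is free, so that angles can be measured
  from whichever direction an argument singles out.\<close>

lemma polar_form:
  fixes x :: "real^2"
  obtains \<theta> where "a \<le> \<theta>" "\<theta> < a + 2 * pi" "x = norm x *\<^sub>R unit_dir \<theta>"
proof -
  have "\<exists>t. x = norm x *\<^sub>R unit_dir t"
  proof (cases "x = 0")
    case False
    have "(norm x)\<^sup>2 = (x $ 1)\<^sup>2 + (x $ 2)\<^sup>2"
      unfolding power2_norm_eq_inner by (simp add: inner_vec_def sum_2 power2_eq_square)
    moreover have "(norm x)\<^sup>2 \<noteq> 0"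
      using False by simp
    ultimately have "(x $ 1 / norm x)\<^sup>2 + (x $ 2 / norm x)\<^sup>2 = 1"
      by (metis add_divide_distrib divide_self power_divide)
    then obtain t where "x $ 1 / norm x = cos t" "x $ 2 / norm x = sin t"
      using sincos_total_2pi by metis
    with False have "x $ 1 = norm x * cos t" "x $ 2 = norm x * sin t"
      by (metis nonzero_mult_div_cancel_left norm_eq_zero times_divide_eq_right)+
    then have "x = norm x *\<^sub>R unit_dir t"
      unfolding vec_eq_iff forall_2 unit_dir_def by simp
    then show ?thesis ..
  qed simp
  then obtain t where t: "x = norm x *\<^sub>R unit_dir t" ..
  define k where "k = - \<lfloor>(t - a) / (2 * pi)\<rfloor>"
  have "of_int (- k) \<le> (t - a) / (2 * pi)" "(t - a) / (2 * pi) < of_int (- k) + 1"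
    unfolding k_def by linarith+
  then have "a \<le> t + 2 * pi * of_int k" "t + 2 * pi * of_int k < a + 2 * pi"
    by (simp_all add: field_simps)
  with that t show thesis
    by (metis unit_dir_periodic)
qed

lemma polar_inner:
  fixes x y :: "real^2"
  assumes "x = norm x *\<^sub>R unit_dir \<theta>" "y = norm y *\<^sub>R unit_dir \<phi>"
  shows "x \<bullet> y = norm x * norm y * cos (\<theta> - \<phi>)"
proof -
  have "x \<bullet> y = (norm x *\<^sub>R unit_dir \<theta>) \<bullet> (norm y *\<^sub>R unit_dir \<phi>)"
    using assms by simp
  then show ?thesis
    by (simp add: unit_dir_inner)
qed

lemma polar_norm_diff:
  fixes x y :: "real^2"
  assumes "x = norm x *\<^sub>R unit_dir \<theta>" "y = norm y *\<^sub>R unit_dir \<phi>"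
  shows "(norm (x - y))\<^sup>2 = (norm x)\<^sup>2 + (norm y)\<^sup>2 - 2 * (norm x * norm y * cos (\<theta> - \<phi>))"
  using polar_inner[OF assms]
  by (simp add: power2_norm_eq_inner inner_diff inner_commute)

lemma polar_norm_add:
  fixes x y :: "real^2"
  assumes "x = norm x *\<^sub>R unit_dir \<theta>" "y = norm y *\<^sub>R unit_dir \<phi>"
  shows "(norm (x + y))\<^sup>2 = (norm x)\<^sup>2 + (norm y)\<^sup>2 + 2 * (norm x * norm y * cos (\<theta> - \<phi>))"
  using polar_inner[OF assms]
  by (simp add: power2_norm_eq_inner inner_add inner_commute)

text \<open>In a triangle, an angle of at most pi/3 faces a side no longer than the longer of the
  other two, which here would be shorter than \<open>R\<close>.\<close>

lemma cos_less_half_if_separated: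
  fixes x y :: "real^2"
  assumes "x = norm x *\<^sub>R unit_dir \<theta>" "y = norm y *\<^sub>R unit_dir \<phi>"
    and "norm x < R" "norm y < R" "R \<le> norm (x - y)"
  shows "cos (\<theta> - \<phi>) < 1 / 2"
proof (rule ccontr)
  let ?r = "norm x" and ?s = "norm y"
  assume "\<not> cos (\<theta> - \<phi>) < 1 / 2"
  then have "?r * ?s * (1 / 2) \<le> ?r * ?s * cos (\<theta> - \<phi>)"
    by (intro mult_left_mono) auto
  with polar_norm_diff[OF assms(1,2)] have *: "(norm (x - y))\<^sup>2 \<le> ?r\<^sup>2 + ?s\<^sup>2 - ?r * ?s"
    by simp
  have "R\<^sup>2 \<le> (norm (x - y))\<^sup>2"
    using assms(3,5) by (intro power_mono) (auto intro: order_trans[OF norm_ge_zero less_imp_le])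
  moreover have "?r\<^sup>2 < R\<^sup>2" "?s\<^sup>2 < R\<^sup>2"
    using assms(3,4) by (auto intro!: power_strict_mono)
  moreover have "?r\<^sup>2 + ?s\<^sup>2 - ?r * ?s \<le> max (?r\<^sup>2) (?s\<^sup>2)"
  proof (cases "?r \<le> ?s")
    case True
    then have "?r * ?r \<le> ?r * ?s" by (intro mult_left_mono) auto
    then show ?thesis by (simp add: power2_eq_square max_def)
  next
    case False
    then have "?s * ?s \<le> ?r * ?s" by (intro mult_right_mono) auto
    then show ?thesis by (simp add: power2_eq_square max_def)
  qed
  ultimately show False
    using * by linarith
qed

text \<open>Laid head to tail, \<open>x\<close> and \<open>y\<close> form a triangle with third side
  \<open>x + y\<close>. The angle facing this shortest side is below pi/3, and it is the supplement
  of the angle between the two vectors.\<close>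

lemma cos_less_neg_half_if_sum_short:
  fixes x y :: "real^2"
  assumes "x = norm x *\<^sub>R unit_dir \<theta>" "y = norm y *\<^sub>R unit_dir \<phi>"
    and "norm (x + y) < norm x" "norm (x + y) \<le> norm y"
  shows "cos (\<theta> - \<phi>) < - 1 / 2"
proof (rule ccontr)
  let ?r = "norm x" and ?s = "norm y" and ?w = "norm (x + y)"
  assume "\<not> cos (\<theta> - \<phi>) < - 1 / 2"
  then have "?r * ?s * (- 1 / 2) \<le> ?r * ?s * cos (\<theta> - \<phi>)"
    by (intro mult_left_mono) auto
  with polar_norm_add[OF assms(1,2)] have *: "?r\<^sup>2 + ?s\<^sup>2 - ?r * ?s \<le> ?w\<^sup>2"
    by simp
  have w: "?w\<^sup>2 < ?r\<^sup>2" "?w\<^sup>2 \<le> ?s\<^sup>2"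
    using assms(3,4) by (auto intro!: power_strict_mono power_mono)
  show False
  proof (cases "?r \<le> ?s")
    case True
    then have "?r * ?s \<le> ?s * ?s" by (intro mult_right_mono) auto
    then show ?thesis using * w(1) by (simp add: power2_eq_square)
  next
    case False
    then have "?r * ?s < ?r * ?r"
      by (intro mult_strict_left_mono) (use False norm_ge_zero[of y] in linarith)+
    then show ?thesis using * w(2) by (simp add: power2_eq_square)
  qed
qed

text \<open>The upper bound is the same gap seen the other way round the circle; with it, angles
  from a range of length 2 pi are compared without reduction.\<close>

lemma angle_gt_if_cos_less_half:
  assumes "cos d < 1 / 2" "\<bar>d\<bar> \<le> 2 * pi"
  shows "pi / 3 < \<bar>d\<bar>" "\<bar>d\<bar> < 5 * pi / 3"
proof -
  have c: "cos \<bar>d\<bar> < 1 / 2"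
    using assms(1) by simp
  show "pi / 3 < \<bar>d\<bar>"
  proof (rule ccontr)
    assume "\<not> pi / 3 < \<bar>d\<bar>"
    then have "cos (pi / 3) \<le> cos \<bar>d\<bar>"
      by (intro cos_monotone_0_pi_le) (use pi_gt_zero in linarith)+
    with c show False by (simp add: cos_60)
  qed
  show "\<bar>d\<bar> < 5 * pi / 3"
  proof (rule ccontr)
    assume "\<not> \<bar>d\<bar> < 5 * pi / 3"
    then have "cos (pi / 3) \<le> cos (2 * pi - \<bar>d\<bar>)"
      using assms(2) by (intro cos_monotone_0_pi_le) (use pi_gt_zero in linarith)+
    with c show False by (simp add: cos_60 cos_diff)
  qed
qed

lemma angle_gt_if_cos_less_neg_half:
  assumes "cos d < - 1 / 2"
  shows "2 * pi / 3 < \<bar>d\<bar>"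
proof (rule ccontr)
  assume "\<not> 2 * pi / 3 < \<bar>d\<bar>"
  then have "cos (2 * pi / 3) \<le> cos \<bar>d\<bar>"
    by (intro cos_monotone_0_pi_le) (use pi_gt_zero in linarith)+
  with assms show False by (simp add: cos_120)
qed

section \<open>Packing separated vectors by angle\<close>

lemma separated_reals_spread:
  fixes \<theta> :: "'i \<Rightarrow> real"
  assumes "finite I" "k + 1 \<le> card I" "1 \<le> k"
    and "\<And>i j. i \<in> I \<Longrightarrow> j \<in> I \<Longrightarrow> i \<noteq> j \<Longrightarrow> g < \<bar>\<theta> i - \<theta> j\<bar>"
  shows "\<exists>i\<in>I. \<exists>j\<in>I. i \<noteq> j \<and> real k * g < \<theta> j - \<theta> i"
  using assms(3,1,2,4)
proof (induction k arbitrary: I rule: dec_induct)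
  case base
  then have "\<not> card I \<le> Suc 0"
    by simp
  then obtain i j where ij: "i \<in> I" "j \<in> I" "i \<noteq> j"
    using card_le_Suc0_iff_eq[OF base.prems(1)] by blast
  then have "g < \<bar>\<theta> i - \<theta> j\<bar>"
    by (rule base.prems(3))
  then have "real 1 * g < \<theta> j - \<theta> i \<or> real 1 * g < \<theta> i - \<theta> j"
    by (simp only: of_nat_1 mult_1_left) linarith
  then show ?case
  proof
    assume "real 1 * g < \<theta> j - \<theta> i"
    with ij show ?case
      by (intro bexI[of _ i] bexI[of _ j] conjI)
  next
    assume "real 1 * g < \<theta> i - \<theta> j"
    with ij ij(3)[symmetric] show ?case
      by (intro bexI[of _ j] bexI[of _ i] conjI)
  qed
next
  case (step n)
  \<comment> \<open>Removing an element with the largest \<open>\<theta>\<close> leaves one gap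
    fewer; that element then lies more than \<open>g\<close> beyond the upper member of the pair
    found for the rest.\<close>
  have "I \<noteq> {}"
    using step.prems(2) by auto
  then have "Max (\<theta> ` I) \<in> \<theta> ` I"
    using step.prems(1) by (intro Max_in) simp_all
  then obtain m where "m \<in> I" "\<theta> m = Max (\<theta> ` I)"
    by (metis imageE)
  with step.prems(1) have m: "m \<in> I" "\<And>i. i \<in> I \<Longrightarrow> \<theta> i \<le> \<theta> m"
    by simp_all
  have "\<exists>i\<in>I - {m}. \<exists>j\<in>I - {m}. i \<noteq> j \<and> real n * g < \<theta> j - \<theta> i"
  proof (rule step.IH)
    show "finite (I - {m})" "n + 1 \<le> card (I - {m})"
      using step.prems(1,2) m(1) by simp_all
    show "g < \<bar>\<theta> i - \<theta> j\<bar>" if "i \<in> I - {m}" "j \<in> I - {m}" "i \<noteq> j" for i j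
      using that by (intro step.prems(3)) blast+
  qed
  then obtain i j where ij: "i \<in> I" "j \<in> I - {m}" "real n * g < \<theta> j - \<theta> i" "i \<in> I - {m}"
    by blast
  moreover have "g < \<theta> m - \<theta> j"
  proof -
    have "g < \<bar>\<theta> m - \<theta> j\<bar>"
      using m(1) ij(2) by (intro step.prems(3)) auto
    moreover have "\<theta> j \<le> \<theta> m"
      using m(2) ij(2) by blast
    ultimately show ?thesis
      by linarith
  qed
  ultimately have "real (Suc n) * g < \<theta> m - \<theta> i"
    by (simp add: algebra_simps)
  moreover have "i \<noteq> m"
    using ij(4) by blast
  ultimately show ?case
    using m(1) ij(1) by (intro bexI[of _ i] bexI[of _ m] conjI)
qed

text \<open>The left side is |P + Q - W|^2 - |P|^2 for vectors of lengths \<open>p\<close>,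
  \<open>q\<close>, \<open>c\<close>, where W lies between P and Q at angles \<alpha> and \<beta>
  from them. It is affine in \<open>p\<close> with nonpositive slope, so \<open>p\<close> may be
  lowered to \<open>q\<close>.\<close>

lemma corner_sum_inequality:
  fixes c q p :: real
  assumes "0 \<le> c" "c \<le> q" "q \<le> p"
    and "pi / 3 \<le> \<alpha>" "\<alpha> \<le> 2 * pi / 3" "pi / 3 \<le> \<beta>" "\<beta> \<le> 2 * pi / 3" "\<alpha> + \<beta> \<le> pi"
  shows "q\<^sup>2 + c\<^sup>2 + 2 * p * q * cos (\<alpha> + \<beta>) - 2 * c * p * cos \<alpha> - 2 * c * q * cos \<beta> \<le> 0"
proof -
  let ?S = "cos (\<alpha> + \<beta>)"
  have double: "?S = 2 * (cos ((\<alpha> + \<beta>) / 2))\<^sup>2 - 1"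
    unfolding cos_double_cos[symmetric] by (simp only: nonzero_mult_div_cancel_left times_divide_eq_right)
  have S: "?S \<le> - 1 / 2"
    using cos_monotone_0_pi_le[of "2 * pi / 3" "\<alpha> + \<beta>"] assms by (simp add: cos_120)
  have "- 1 / 2 \<le> cos \<alpha>"
    using cos_monotone_0_pi_le[of \<alpha> "2 * pi / 3"] assms by (simp add: cos_120)
  then have "c * (- 1 / 2) \<le> c * cos \<alpha>"
    using assms(1) by (intro mult_left_mono) auto
  moreover have "q * ?S \<le> q * (- 1 / 2)"
    using S assms by (intro mult_left_mono) auto
  ultimately have "q * ?S - c * cos \<alpha> \<le> 0"
    using assms(2) by linarith
  then have "p * (q * ?S - c * cos \<alpha>) \<le> q * (q * ?S - c * cos \<alpha>)"
    using assms(3) by (intro mult_right_mono_neg) auto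
  then have "q\<^sup>2 + c\<^sup>2 + 2 * p * q * ?S - 2 * c * p * cos \<alpha> - 2 * c * q * cos \<beta>
      \<le> q\<^sup>2 + c\<^sup>2 + 2 * (q * (q * ?S - c * cos \<alpha>)) - 2 * c * q * cos \<beta>"
    by (simp add: algebra_simps)
  also have "\<dots> \<le> q\<^sup>2 + c * q + 2 * (q * (q * ?S - c * cos \<alpha>)) - 2 * c * q * cos \<beta>"
    using mult_left_mono[OF assms(2,1)] by (simp add: power2_eq_square)
  \<comment> \<open>Both summands are nonpositive: the first because the cosine of the full angle is
    at most -1/2, the second, after turning sums of cosines into products, because half the
    difference of the angles does not exceed half their sum.\<close>
  also have "\<dots> = (q - c) * q * (1 + 2 * ?S) + 2 * (c * q) * (1 + ?S - (cos \<alpha> + cos \<beta>))"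
    by (simp add: algebra_simps power2_eq_square)
  also have "1 + ?S - (cos \<alpha> + cos \<beta>)
      = 2 * cos ((\<alpha> + \<beta>) / 2) * (cos ((\<alpha> + \<beta>) / 2) - cos ((\<alpha> - \<beta>) / 2))"
    using cos_plus_cos[of \<alpha> \<beta>] double by (simp add: algebra_simps power2_eq_square)
  finally have *: "q\<^sup>2 + c\<^sup>2 + 2 * p * q * ?S - 2 * c * p * cos \<alpha> - 2 * c * q * cos \<beta>
      \<le> (q - c) * q * (1 + 2 * ?S)
        + 2 * (c * q) * (2 * cos ((\<alpha> + \<beta>) / 2) * (cos ((\<alpha> + \<beta>) / 2) - cos ((\<alpha> - \<beta>) / 2)))" .
  have "(q - c) * q * (1 + 2 * ?S) \<le> 0"
    using assms S by (intro mult_nonneg_nonpos) auto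
  moreover have "0 \<le> \<alpha> + \<beta>"
    using assms(4,6) pi_gt_zero by linarith
  then have "0 \<le> cos ((\<alpha> + \<beta>) / 2)"
    using assms(8) by (intro cos_ge_zero) auto
  moreover have "cos ((\<alpha> + \<beta>) / 2) \<le> cos \<bar>(\<alpha> - \<beta>) / 2\<bar>"
    using assms pi_gt_zero by (intro cos_monotone_0_pi_le) (auto simp: abs_le_iff field_simps)
  then have "cos ((\<alpha> + \<beta>) / 2) - cos ((\<alpha> - \<beta>) / 2) \<le> 0"
    unfolding cos_abs_real by simp
  ultimately have "2 * (c * q) * (2 * cos ((\<alpha> + \<beta>) / 2)
      * (cos ((\<alpha> + \<beta>) / 2) - cos ((\<alpha> - \<beta>) / 2))) \<le> 0"
    using assms(1,2) by (intro mult_nonneg_nonpos mult_nonneg_nonneg) auto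
  with * \<open>(q - c) * q * (1 + 2 * ?S) \<le> 0\<close> show ?thesis
    by linarith
qed

text \<open>Six angles in a range of length 2 pi with gaps above pi/3 spread over more than 5 pi/3,
  so two of them are closer than pi/3 the other way round.\<close>

lemma separated_vectors_card:
  fixes v :: "'i \<Rightarrow> real^2"
  assumes "finite I"
    and short: "\<And>i. i \<in> I \<Longrightarrow> norm (v i) < R"
    and sep: "\<And>i j. i \<in> I \<Longrightarrow> j \<in> I \<Longrightarrow> i \<noteq> j \<Longrightarrow> R \<le> norm (v i - v j)"
  shows "card I \<le> 5"
proof (rule ccontr)
  assume "\<not> card I \<le> 5"
  have "\<exists>\<theta>. 0 \<le> \<theta> \<and> \<theta> < 2 * pi \<and> v i = norm (v i) *\<^sub>R unit_dir \<theta>" for i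
    using polar_form[of 0 "v i"] by auto
  then obtain \<theta> where \<theta>: "0 \<le> \<theta> i" "\<theta> i < 2 * pi" "v i = norm (v i) *\<^sub>R unit_dir (\<theta> i)" for i
    by metis
  have far: "pi / 3 < \<bar>\<theta> i - \<theta> j\<bar>" "\<bar>\<theta> i - \<theta> j\<bar> < 5 * pi / 3"
    if "i \<in> I" "j \<in> I" "i \<noteq> j" for i j
  proof -
    have "cos (\<theta> i - \<theta> j) < 1 / 2"
      using that by (intro cos_less_half_if_separated[OF \<theta>(3) \<theta>(3) short short sep])
    moreover have "\<bar>\<theta> i - \<theta> j\<bar> \<le> 2 * pi"
      using \<theta>(1,2)[of i] \<theta>(1,2)[of j] by linarith
    ultimately show "pi / 3 < \<bar>\<theta> i - \<theta> j\<bar>" "\<bar>\<theta> i - \<theta> j\<bar> < 5 * pi / 3"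
      by (rule angle_gt_if_cos_less_half)+
  qed
  obtain i j where "i \<in> I" "j \<in> I" "i \<noteq> j" "real 5 * (pi / 3) < \<theta> j - \<theta> i"
    using separated_reals_spread[of I 5 "pi / 3" \<theta>, OF assms(1) _ one_le_numeral far(1)]
      \<open>\<not> card I \<le> 5\<close> by force
  then show False
    using far(2)[of i j] abs_ge_minus_self[of "\<theta> i - \<theta> j"] by simp
qed

text \<open>The five gaps exceed \<open>\<pi>/3\<close>, so the two angular neighbours \<open>v p\<close>, \<open>v q\<close> of the shortest vector
  enclose an angle less than \<open>\<pi>\<close> around it.\<close>

lemma five_separated_vectors:
  fixes v :: "'i \<Rightarrow> real^2"
  assumes "finite I" "5 \<le> card I" "w \<in> I"
    and short: "\<And>i. i \<in> I \<Longrightarrow> norm (v i) < R"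
    and sep: "\<And>i j. i \<in> I \<Longrightarrow> j \<in> I \<Longrightarrow> i \<noteq> j \<Longrightarrow> R \<le> norm (v i - v j)"
    and least: "\<And>i. i \<in> I \<Longrightarrow> norm (v w) \<le> norm (v i)"
  obtains p q where "p \<in> I" "q \<in> I" "p \<noteq> w" "q \<noteq> w" "p \<noteq> q"
    "norm (v p + v q - v w) \<le> max (norm (v p)) (norm (v q))"
proof -
  obtain \<theta>0 where \<theta>0: "v w = norm (v w) *\<^sub>R unit_dir \<theta>0"
    using polar_form[of 0 "v w"] by auto
  have "\<exists>\<psi>. 0 \<le> \<psi> \<and> \<psi> < 2 * pi \<and> v i = norm (v i) *\<^sub>R unit_dir (\<theta>0 + \<psi>)" for i
  proof -
    obtain \<theta> where "\<theta>0 \<le> \<theta>" "\<theta> < \<theta>0 + 2 * pi" "v i = norm (v i) *\<^sub>R unit_dir \<theta>"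
      using polar_form[of \<theta>0 "v i"] .
    then show ?thesis
      by (intro exI[of _ "\<theta> - \<theta>0"]) auto
  qed
  then obtain \<psi> where \<psi>: "0 \<le> \<psi> i" "\<psi> i < 2 * pi" "v i = norm (v i) *\<^sub>R unit_dir (\<theta>0 + \<psi> i)" for i
    by metis
  have near: "pi / 3 < \<psi> i" "\<psi> i < 5 * pi / 3" if "i \<in> I - {w}" for i
  proof -
    have "cos ((\<theta>0 + \<psi> i) - \<theta>0) < 1 / 2"
      using that assms(3) by (intro cos_less_half_if_separated[OF \<psi>(3) \<theta>0 short short sep]) auto
    then show "pi / 3 < \<psi> i" "\<psi> i < 5 * pi / 3"
      using angle_gt_if_cos_less_half[of "\<psi> i"] \<psi>(1,2)[of i] by auto
  qed
  have far: "pi / 3 < \<bar>\<psi> i - \<psi> j\<bar>" if "i \<in> I - {w}" "j \<in> I - {w}" "i \<noteq> j" for i j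
  proof -
    have "cos ((\<theta>0 + \<psi> i) - (\<theta>0 + \<psi> j)) < 1 / 2"
      using that by (intro cos_less_half_if_separated[OF \<psi>(3) \<psi>(3) short short sep]) auto
    moreover have "\<bar>\<psi> i - \<psi> j\<bar> \<le> 2 * pi"
      using \<psi>(1,2)[of i] \<psi>(1,2)[of j] by linarith
    ultimately show ?thesis
      using angle_gt_if_cos_less_half[of "\<psi> i - \<psi> j"] by auto
  qed
  have fin: "finite (I - {w})" and card: "3 + 1 \<le> card (I - {w})"
    using assms(1-3) by simp_all
  \<comment> \<open>The four remaining angles, measured from the direction of \<open>v w\<close>,
    spread over more than pi; this leaves less than pi on the side that contains
    \<open>v w\<close>.\<close>
  obtain p q where pq: "p \<in> I - {w}" "q \<in> I - {w}" "p \<noteq> q" "real 3 * (pi / 3) < \<psi> q - \<psi> p"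
    using separated_reals_spread[of "I - {w}" 3 "pi / 3" \<psi>, OF fin card one_le_numeral far] by blast
  define \<alpha> \<beta> where "\<alpha> = \<psi> p" and "\<beta> = 2 * pi - \<psi> q"
  have ang: "pi / 3 \<le> \<alpha>" "\<alpha> \<le> 2 * pi / 3" "pi / 3 \<le> \<beta>" "\<beta> \<le> 2 * pi / 3" "\<alpha> + \<beta> \<le> pi"
    using pq near[of p] near[of q] unfolding \<alpha>_def \<beta>_def by linarith+
  let ?P = "norm (v p)" and ?Q = "norm (v q)" and ?c = "norm (v w)"
  have pq_inner: "v p \<bullet> v q = ?P * ?Q * cos (\<alpha> + \<beta>)"
  proof -
    have "cos (\<alpha> + \<beta>) = cos (\<psi> p - \<psi> q + 2 * pi)"
      unfolding \<alpha>_def \<beta>_def by (simp add: algebra_simps)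
    then show ?thesis
      using polar_inner[OF \<psi>(3)[of p] \<psi>(3)[of q]] by simp
  qed
  have po_inner: "v p \<bullet> v w = ?P * ?c * cos \<alpha>"
    using polar_inner[OF \<psi>(3)[of p] \<theta>0] by (simp add: \<alpha>_def)
  have qo_inner: "v q \<bullet> v w = ?Q * ?c * cos \<beta>"
    using polar_inner[OF \<psi>(3)[of q] \<theta>0] by (simp add: \<beta>_def cos_diff)
  have expand: "(norm (v p + v q - v w))\<^sup>2 = ?P\<^sup>2 + ?Q\<^sup>2 + ?c\<^sup>2 + 2 * (v p \<bullet> v q) - 2 * (v p \<bullet> v w) - 2 * (v q \<bullet> v w)"
    by (simp add: power2_norm_eq_inner inner_diff inner_add inner_commute)
  have "(norm (v p + v q - v w))\<^sup>2 \<le> (max ?P ?Q)\<^sup>2"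
  proof (cases "?Q \<le> ?P")
    case True
    with corner_sum_inequality[of ?c ?Q ?P \<alpha> \<beta>] least[of q] pq ang show ?thesis
      unfolding expand pq_inner po_inner qo_inner by (simp add: max_def mult_ac)
  next
    case False
    with corner_sum_inequality[of ?c ?P ?Q \<beta> \<alpha>] least[of p] pq ang show ?thesis
      unfolding expand pq_inner po_inner qo_inner by (simp add: max_def mult_ac add.commute)
  qed
  then have "norm (v p + v q - v w) \<le> max ?P ?Q"
    by (rule power2_le_imp_le) (simp add: max_def)
  with that pq show thesis
    by blast
qed

text \<open>In use, \<open>d\<close> lists lengths in increasing order and \<open>y\<close> the
  coordinates across the axis. The latter grow by a factor \<open>1 + s\<close> per step and bound
  the lengths from below. Unless the claim is immediate, the lengths therefore sum to at least
  \<open>2 * (n - 1) * d 0\<close>, and \<open>sum\<close> limits \<open>n\<close>.\<close>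

lemma chain_growth_bound:
  fixes d y :: "nat \<Rightarrow> real"
  assumes d0: "0 < d 0"
    and y0: "s * d 0 \<le> y 0" and ystep: "\<And>i. Suc i < n \<Longrightarrow> y i + s * d i \<le> y (Suc i)"
    and yd: "\<And>i. i < n \<Longrightarrow> y i \<le> d i"
    and sum: "c * (\<Sum>i<n. d i) \<le> k * d 0"
    and c: "0 < c" "c = sqrt 3 / 2 * s - k / 2" and ks: "k\<^sup>2 + s\<^sup>2 = 1" "0 < k" "1 / 2 \<le> s"
    and n: "1 \<le> n"
  shows "2 * (real n - 1) * c \<le> k"
proof -
  have grow: "(1 + s) * y i \<le> y (Suc i)" if "Suc i < n" for i
  proof -
    have "s * y i \<le> s * d i"
      using yd[of i] that ks(3) by (intro mult_left_mono) auto
    with ystep[OF that] show ?thesis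
      by (simp add: algebra_simps)
  qed
  have y_lower: "2 * s * (1 + s) ^ i * d 0 \<le> y (Suc i)" if "Suc i < n" for i
    using that
  proof (induction i)
    case 0
    with ystep[of 0] y0 show ?case by simp
  next
    case (Suc i)
    then have "(1 + s) * (2 * s * (1 + s) ^ i * d 0) \<le> (1 + s) * y (Suc i)"
      using ks(3) by (intro mult_left_mono) auto
    with grow[OF Suc.prems] show ?case
      by (simp add: algebra_simps)
  qed
  have enough: ?thesis if "2 * (real n - 1) * d 0 \<le> (\<Sum>i<n. d i)"
  proof -
    have "c * (2 * (real n - 1) * d 0) \<le> c * (\<Sum>i<n. d i)"
      using that c(1) by (intro mult_left_mono) auto
    also note sum
    finally have "(2 * (real n - 1) * c) * d 0 \<le> k * d 0"
      by (simp add: mult_ac)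
    then show ?thesis
      using d0 by simp
  qed
  have term_lower: "r * d 0 \<le> d (Suc i)" if "Suc i < n" "r \<le> 2 * s * (1 + s) ^ i" for i r
  proof -
    have "r * d 0 \<le> 2 * s * (1 + s) ^ i * d 0"
      using that d0 by (intro mult_right_mono) auto
    with y_lower[OF that(1)] yd[OF that(1)] show ?thesis
      by linarith
  qed
  have power_mono_s: "2 * b * (1 + b) ^ i \<le> 2 * s * (1 + s) ^ i" if "0 \<le> b" "b \<le> s" for b i
    using that by (intro mult_mono power_mono) auto
  consider "n = 1" | "n = 2" | "n = 3 \<or> n = 4" | "5 \<le> n"
    using n by linarith
  then show ?thesis
  proof cases
    case 1
    then show ?thesis using ks(2) by simp
  next
    case 2
    then have "1 * d 0 \<le> d 1"
      using term_lower[of 0 1] ks(3) by simp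
    with 2 show ?thesis
      by (intro enough) (simp add: numeral_2_eq_2)
  next
    case 3
    \<comment> \<open>Here the claim asks for at most \<open>6 * c \<le> k\<close>, so only
      \<open>k < 6 * c\<close> is left, which forces \<open>s \<ge> 3 / 5\<close>. Growth from
      \<open>s = 1 / 2\<close> would yield only 3.5 and 5.75 times \<open>d 0\<close>, where 4 and 6
      are required.\<close>
    show ?thesis
    proof (cases "k < 6 * c")
      case False
      with 3 c(1) show ?thesis by auto
    next
      case True
      then have "4 * k < 3 * (sqrt 3 * s)"
        unfolding c(2) by (simp add: mult.commute)
      then have "(4 * k)\<^sup>2 < (3 * (sqrt 3 * s))\<^sup>2"
        using ks(2) by (intro power_strict_mono) auto
      then have "16 * k\<^sup>2 < 27 * s\<^sup>2"
        by (simp add: power_mult_distrib)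
      then have "(3 / 5)\<^sup>2 < s\<^sup>2"
        using ks(1) by (simp add: power2_eq_square)
      then have s: "3 / 5 \<le> s"
        using ks(3) by (metis less_eq_real_def power_less_imp_less_base zero_less_divide_1_iff
            zero_less_numeral order_trans)
      have low: "2 * (3 / 5) * (1 + 3 / 5) ^ i * d 0 \<le> d (Suc i)" if "Suc i < n" for i
        using term_lower[OF that power_mono_s[OF _ s]] by simp
      show ?thesis
      proof (cases "n = 3")
        case True
        with low[of 0] low[of 1] d0 show ?thesis
          by (intro enough) (simp add: numeral_eq_Suc)
      next
        case False
        with 3 have "n = 4" by simp
        with low[of 0] low[of 1] low[of 2] d0 show ?thesis
          by (intro enough) (simp add: numeral_eq_Suc)
      qed
    qed
  next
    case 4
    have low: "2 * (1 / 2) * (1 + 1 / 2) ^ i * d 0 \<le> d (Suc i)" if "Suc i < n" for i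
      using term_lower[OF that power_mono_s[of "1 / 2"]] ks(3) by simp
    \<comment> \<open>From five terms on, \<open>s \<ge> 1 / 2\<close> suffices: 1 + 1 + 1.5 + 2.25
      + 3.375 exceeds 8, and every further term contributes at least \<open>2 * d 0\<close>.\<close>
    have "2 * (real m - 1) * d 0 \<le> (\<Sum>i<m. d i)" if "5 \<le> m" "m \<le> n" for m
      using that
    proof (induction m rule: dec_induct)
      case base
      with low[of 0] low[of 1] low[of 2] low[of 3] d0 show ?case
        by (simp add: numeral_eq_Suc)
    next
      case (step m)
      have "2 \<le> (3 / 2 :: real) ^ 2" by (simp add: power2_eq_square)
      also have "(3 / 2 :: real) ^ 2 \<le> (3 / 2) ^ (m - 1)"
        using step.hyps by (intro power_increasing) auto
      finally have "2 * d 0 \<le> (3 / 2) ^ (m - 1) * d 0"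
        using d0 by (intro mult_right_mono) auto
      also have "\<dots> \<le> d m"
        using low[of "m - 1"] step by simp
      finally show ?case
        using step by (simp add: algebra_simps)
    qed
    with 4 show ?thesis
      by (intro enough) auto
  qed
qed

section \<open>Short vectors in a wedge\<close>

text \<open>Listing \<open>S\<close> by increasing length makes the coordinate \<open>X\<close>
  along the axis telescope: at the shortest element it is at least \<open>c\<close> times the sum of
  all lengths, yet at most \<open>k\<close> times that shortest length. \<open>Y\<close> is the
  coordinate across the axis.\<close>

lemma chain_card_bound:
  fixes X Y :: "real \<Rightarrow> real"
  assumes "finite S" "S \<noteq> {}"
    and pos: "\<And>d. d \<in> S \<Longrightarrow> 0 < d"
    and X_low: "\<And>d. d \<in> S \<Longrightarrow> c * d \<le> X d" and X_up: "\<And>d. d \<in> S \<Longrightarrow> X d \<le> k * d"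
    and Y_low: "\<And>d. d \<in> S \<Longrightarrow> s * d \<le> Y d" and Y_up: "\<And>d. d \<in> S \<Longrightarrow> Y d \<le> d"
    and X_step: "\<And>d d'. d \<in> S \<Longrightarrow> d' \<in> S \<Longrightarrow> d' < d \<Longrightarrow> X d + c * d' \<le> X d'"
    and Y_step: "\<And>d d'. d \<in> S \<Longrightarrow> d' \<in> S \<Longrightarrow> d' < d \<Longrightarrow> Y d' + s * d' \<le> Y d"
    and c: "0 < c" "c = sqrt 3 / 2 * s - k / 2" and ks: "k\<^sup>2 + s\<^sup>2 = 1" "0 < k" "1 / 2 \<le> s"
  shows "2 * (real (card S) - 1) * c \<le> k"
proof -
  define n where "n = card S"
  define f where "f = (\<lambda>i. sorted_list_of_set S ! i)"
  have n: "1 \<le> n"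
    using assms(1,2) by (simp add: n_def Suc_le_eq card_gt_0_iff)
  have len: "length (sorted_list_of_set S) = n"
    using assms(1) by (simp add: n_def)
  have f_in: "f i \<in> S" if "i < n" for i
    using nth_mem[of i "sorted_list_of_set S"] that len assms(1) by (simp add: f_def)
  have f_less: "f i < f j" if "i < j" "j < n" for i j
    using sorted_wrt_nth_less[OF strict_sorted_list_of_set, of i j S] that len by (simp add: f_def)
  have bij: "bij_betw f {..<n} S"
    using bij_betw_nth[of "sorted_list_of_set S" "{..<n}" S] assms(1) len by (simp add: f_def)
  have partial: "c * (\<Sum>i\<in>{m..<n}. f i) \<le> X (f m)" if "m < n" for m
    using that
  proof (induction "n - m" arbitrary: m)
    case (Suc j)
    show ?case
    proof (cases "Suc m < n")
      case True
      have "c * (\<Sum>i\<in>{m..<n}. f i) = c * f m + c * (\<Sum>i\<in>{Suc m..<n}. f i)"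
        using Suc.prems by (simp add: sum.atLeast_Suc_lessThan algebra_simps)
      also have "\<dots> \<le> c * f m + X (f (Suc m))"
        using Suc True by simp
      also have "\<dots> \<le> X (f m)"
        using X_step[of "f (Suc m)" "f m"] f_in Suc.prems True f_less by simp
      finally show ?thesis .
    next
      case False
      with Suc.prems have "{m..<n} = {m}" by auto
      then show ?thesis
        using X_low[OF f_in[OF Suc.prems]] by simp
    qed
  qed simp
  have "c * (\<Sum>i<n. f i) \<le> k * f 0"
    using partial[of 0] X_up[OF f_in[of 0]] n by (simp add: atLeast0LessThan)
  moreover have "0 < f 0" "s * f 0 \<le> Y (f 0)"
    using pos[OF f_in[of 0]] Y_low[OF f_in[of 0]] n by simp_all
  moreover have "Y (f i) + s * f i \<le> Y (f (Suc i))" if "Suc i < n" for i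
    using Y_step[of "f (Suc i)" "f i"] f_in that f_less by simp
  moreover have "Y (f i) \<le> f i" if "i < n" for i
    using Y_up f_in that by simp
  ultimately have "2 * (real n - 1) * c \<le> k"
    using c ks n by (intro chain_growth_bound[of f s "Y \<circ> f" n c k]) auto
  then show ?thesis
    by (simp add: n_def)
qed

text \<open>A set of short vectors in the wedge of half-angle \<open>\<beta>\<close> around the direction \<open>\<gamma>\<close>, indexed by
  their lengths: passing to a shorter vector means either a jump of length at least \<open>R\<close> or a step
  inside the wedge that is not shorter than the vector reached.\<close>

locale wedge_records =
  fixes S :: "real set" and \<gamma> \<beta> R :: real and e :: "real \<Rightarrow> real^2" and \<theta> :: "real \<Rightarrow> real"
  assumes fin: "finite S" and beta: "0 \<le> \<beta>" "\<beta> < pi / 2"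
    and pos: "\<And>d. d \<in> S \<Longrightarrow> 0 < d" and short: "\<And>d. d \<in> S \<Longrightarrow> d < R"
    and norm_e: "\<And>d. d \<in> S \<Longrightarrow> norm (e d) = d"
    and polar_e: "\<And>d. d \<in> S \<Longrightarrow> e d = norm (e d) *\<^sub>R unit_dir (\<gamma> + \<theta> d)"
    and wedge: "\<And>d. d \<in> S \<Longrightarrow> \<bar>\<theta> d\<bar> \<le> \<beta>"
    and step: "\<And>d d'. d \<in> S \<Longrightarrow> d' \<in> S \<Longrightarrow> d' < d \<Longrightarrow> norm (e d' - e d) < R \<Longrightarrow>
      d' \<le> norm (e d' - e d) \<and>
      (\<exists>\<phi>. \<bar>\<phi>\<bar> \<le> \<beta> \<and> e d' - e d = norm (e d' - e d) *\<^sub>R unit_dir (\<gamma> + \<phi>))"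
begin

definition jump_only :: "real \<Rightarrow> bool" where
  "jump_only d \<longleftrightarrow> (\<forall>d'\<in>S. d' < d \<longrightarrow> R \<le> norm (e d' - e d))"

text \<open>\<open>e d'\<close> is the sum of \<open>e d\<close> and the step; it is shorter than
  the former and no longer than the latter.\<close>

lemma step_angle:
  assumes "d \<in> S" "d' \<in> S" "d' < d" "norm (e d' - e d) < R"
  obtains \<phi> where "\<bar>\<phi>\<bar> \<le> \<beta>" "e d' - e d = norm (e d' - e d) *\<^sub>R unit_dir (\<gamma> + \<phi>)"
    "d' \<le> norm (e d' - e d)" "2 * pi / 3 < \<bar>\<theta> d - \<phi>\<bar>"
proof -
  obtain \<phi> where \<phi>: "\<bar>\<phi>\<bar> \<le> \<beta>" "e d' - e d = norm (e d' - e d) *\<^sub>R unit_dir (\<gamma> + \<phi>)"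
    "d' \<le> norm (e d' - e d)"
    using step[OF assms] by blast
  have "cos ((\<gamma> + \<theta> d) - (\<gamma> + \<phi>)) < - 1 / 2"
    using assms \<phi>(3)
    by (intro cos_less_neg_half_if_sum_short[OF polar_e[OF assms(1)] \<phi>(2)]) (simp_all add: norm_e)
  then have "2 * pi / 3 < \<bar>\<theta> d - \<phi>\<bar>"
    using angle_gt_if_cos_less_neg_half[of "\<theta> d - \<phi>"] by simp
  with \<phi> that show thesis
    by blast
qed

lemma jump_angle:
  assumes "d \<in> S" "d' \<in> S" "R \<le> norm (e d' - e d)"
  shows "pi / 3 < \<bar>\<theta> d' - \<theta> d\<bar>"
proof -
  have "cos ((\<gamma> + \<theta> d') - (\<gamma> + \<theta> d)) < 1 / 2"
    using assms short
    by (intro cos_less_half_if_separated[OF polar_e[OF assms(2)] polar_e[OF assms(1)] _ _ assms(3)])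
      (simp_all add: norm_e)
  moreover have "\<bar>\<theta> d' - \<theta> d\<bar> \<le> 2 * pi"
    using wedge[OF assms(1)] wedge[OF assms(2)] beta pi_gt_zero by linarith
  ultimately show ?thesis
    using angle_gt_if_cos_less_half(1)[of "\<theta> d' - \<theta> d"] by simp
qed

text \<open>Jumps force angles above pi/3, so \<open>k + 1\<close> such vectors would not fit into a
  wedge of width \<open>2 * \<beta>\<close>.\<close>

lemma card_jump_only:
  assumes "A \<subseteq> S" "\<And>d. d \<in> A \<Longrightarrow> jump_only d" "1 \<le> k" "2 * \<beta> \<le> real k * (pi / 3)"
  shows "card A \<le> k"
proof (rule ccontr)
  assume "\<not> card A \<le> k"
  then have k: "k + 1 \<le> card A"
    by simp
  have "finite A"
    using assms(1) fin finite_subset by blast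
  moreover have far: "pi / 3 < \<bar>\<theta> d - \<theta> d'\<bar>" if "d \<in> A" "d' \<in> A" "d \<noteq> d'" for d d'
  proof -
    have S: "d \<in> S" "d' \<in> S"
      using that assms(1) by blast+
    have "R \<le> norm (e d - e d')"
    proof (cases "d < d'")
      case True
      with assms(2)[OF that(2)] S show ?thesis
        by (simp add: jump_only_def)
    next
      case False
      with assms(2)[OF that(1)] S that(3) have "R \<le> norm (e d' - e d)"
        by (simp add: jump_only_def)
      then show ?thesis
        by (simp add: norm_minus_commute)
    qed
    with S show ?thesis
      by (intro jump_angle)
  qed
  ultimately obtain i j where "i \<in> A" "j \<in> A" "real k * (pi / 3) < \<theta> j - \<theta> i"
    using separated_reals_spread[of A k "pi / 3" \<theta>, OF _ k assms(3) far] by blast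
  moreover from this assms(1) have "\<bar>\<theta> i\<bar> \<le> \<beta>" "\<bar>\<theta> j\<bar> \<le> \<beta>"
    using wedge by blast+
  ultimately show False
    using assms(4) by linarith
qed

text \<open>Directions in the wedge differ by at most 2 pi/3, so no step is possible and only jumps
  remain.\<close>

lemma card_narrow:
  assumes "\<beta> \<le> pi / 3"
  shows "card S \<le> 2"
proof (rule card_jump_only)
  fix d assume d: "d \<in> S"
  have "R \<le> norm (e d' - e d)" if d': "d' \<in> S" "d' < d" for d'
  proof (rule ccontr)
    assume "\<not> R \<le> norm (e d' - e d)"
    then obtain \<phi> where "\<bar>\<phi>\<bar> \<le> \<beta>" "2 * pi / 3 < \<bar>\<theta> d - \<phi>\<bar>"
      using step_angle[of d d'] d d' by (metis not_le)
    with wedge[OF d] assms show False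
      by linarith
  qed
  then show "jump_only d"
    by (simp add: jump_only_def)
qed (use assms in auto)

section \<open>Chains along an edge of the wedge\<close>

lemma components:
  assumes "x = norm x *\<^sub>R unit_dir (\<gamma> + \<phi>)"
  shows "x \<bullet> unit_dir \<gamma> = norm x * cos \<phi>" "x \<bullet> unit_dir (\<gamma> + pi / 2) = norm x * sin \<phi>"
proof -
  show "x \<bullet> unit_dir \<gamma> = norm x * cos \<phi>"
    using polar_inner[OF assms, of "unit_dir \<gamma>" \<gamma>] by simp
  have "cos (\<phi> - pi / 2) = sin \<phi>"
    by (simp add: cos_diff)
  then show "x \<bullet> unit_dir (\<gamma> + pi / 2) = norm x * sin \<phi>"
    using polar_inner[OF assms, of "unit_dir (\<gamma> + pi / 2)" "\<gamma> + pi / 2"] by (simp add: algebra_simps)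
qed

text \<open>\<open>\<sigma>\<close> selects the edge. The vectors of \<open>A\<close> span less than
  pi/3, so passing between two of them is never a jump. The resulting step points towards the
  opposite edge; it raises the coordinate along the axis and lowers the one across it.\<close>

lemma card_side:
  assumes wide: "pi / 3 < \<beta>" and \<sigma>: "\<sigma> = 1 \<or> \<sigma> = - 1"
    and A: "A \<subseteq> S" "\<And>d. d \<in> A \<Longrightarrow> 2 * pi / 3 - \<beta> < \<sigma> * \<theta> d"
  shows "real (card A) - 1 \<le> sin (\<beta> - pi / 6) / sin (2 * \<beta>)"
proof -
  \<comment> \<open>\<open>c\<close> bounds the cosine of every angle in the wedge from below;
    \<open>s\<close> and \<open>k\<close> turn out to be the sine and cosine of 2 pi/3 - \<beta>,
    the inner boundary of the sector containing \<open>A\<close>.\<close>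
  define s c k where "s = cos (\<beta> - pi / 6)" and "c = cos \<beta>" and "k = sin (\<beta> - pi / 6)"
  have s_sin: "sin (2 * pi / 3 - \<beta>) = s" and k_cos: "cos (2 * pi / 3 - \<beta>) = k"
    unfolding s_def k_def by (simp_all add: sin_diff cos_diff cos_120 sin_120 cos_30 sin_30)
  have c: "0 < c" "c = sqrt 3 / 2 * s - k / 2"
  proof -
    show "0 < c"
      unfolding c_def using beta by (intro cos_gt_zero_pi) auto
    have "\<beta> = (\<beta> - pi / 6) + pi / 6" by simp
    then have "cos \<beta> = cos (\<beta> - pi / 6) * cos (pi / 6) - sin (\<beta> - pi / 6) * sin (pi / 6)"
      by (metis cos_add)
    then show "c = sqrt 3 / 2 * s - k / 2"
      by (simp add: c_def s_def k_def cos_30 sin_30)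
  qed
  have k: "0 < k"
    unfolding k_def using beta wide pi_gt_zero by (intro sin_gt_zero) linarith+
  have s: "1 / 2 \<le> s"
    unfolding s_def cos_60[symmetric] using beta wide pi_gt_zero
    by (intro cos_monotone_0_pi_le) linarith+
  have ks: "k\<^sup>2 + s\<^sup>2 = 1"
    by (simp add: k_def s_def)
  have cos_\<sigma>: "cos (\<sigma> * t) = cos t" and sin_\<sigma>: "sin (\<sigma> * t) = \<sigma> * sin t" and abs_\<sigma>: "\<bar>\<sigma> * t\<bar> = \<bar>t\<bar>" for t
    using \<sigma> by auto
  have sin_ge: "s \<le> sin t" if "2 * pi / 3 - \<beta> < t" "t \<le> \<beta>" for t
    unfolding s_sin[symmetric] using that beta by (intro sin_monotone_2pi_le) auto
  have cos_ge: "c \<le> cos t" if "\<bar>t\<bar> \<le> \<beta>" for t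
  proof -
    have "cos \<beta> \<le> cos \<bar>t\<bar>"
      using that beta by (intro cos_monotone_0_pi_le) auto
    then show ?thesis
      by (simp add: c_def)
  qed
  have angle: "2 * pi / 3 - \<beta> < \<sigma> * \<theta> d" "\<sigma> * \<theta> d \<le> \<beta>" "d \<in> S" if "d \<in> A" for d
    using A that wedge[of d] abs_\<sigma>[of "\<theta> d"] abs_ge_self[of "\<sigma> * \<theta> d"] by auto
  have move: "d * cos (\<theta> d) + c * d' \<le> d' * cos (\<theta> d')"
    "\<sigma> * (d' * sin (\<theta> d')) + s * d' \<le> \<sigma> * (d * sin (\<theta> d))"
    if dd: "d \<in> A" "d' \<in> A" "d' < d" for d d'
  proof -
    let ?z = "e d' - e d"
    note S = angle(3)[OF dd(1)] angle(3)[OF dd(2)]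
    have "\<bar>\<theta> d' - \<theta> d\<bar> = \<bar>\<sigma> * \<theta> d' - \<sigma> * \<theta> d\<bar>"
      using \<sigma> by auto
    also have "\<dots> \<le> pi / 3"
      using angle[OF dd(1)] angle[OF dd(2)] beta by linarith
    finally have "norm ?z < R"
      using jump_angle[OF S] by linarith
    then obtain \<phi> where \<phi>: "\<bar>\<phi>\<bar> \<le> \<beta>" "?z = norm ?z *\<^sub>R unit_dir (\<gamma> + \<phi>)"
      "d' \<le> norm ?z" "2 * pi / 3 < \<bar>\<theta> d - \<phi>\<bar>"
      using step_angle[OF S dd(3)] by blast
    have "\<bar>\<theta> d - \<phi>\<bar> = \<bar>\<sigma> * \<theta> d - \<sigma> * \<phi>\<bar>"
      using \<sigma> by auto
    moreover have abs\<phi>: "\<bar>\<sigma> * \<phi>\<bar> \<le> \<beta>"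
      using \<phi>(1) abs_\<sigma> by simp
    ultimately have neg: "2 * pi / 3 - \<beta> < - (\<sigma> * \<phi>)" "- (\<sigma> * \<phi>) \<le> \<beta>"
      using \<phi>(4) angle[OF dd(1)] beta by linarith+
    have d'0: "0 < d'"
      using pos S(2) by blast
    have "d' * cos (\<theta> d') - d * cos (\<theta> d) = ?z \<bullet> unit_dir \<gamma>"
      using components(1)[OF polar_e] S norm_e by (simp add: inner_diff_left)
    also have "\<dots> = norm ?z * cos \<phi>"
      by (rule components(1)[OF \<phi>(2)])
    also have "\<dots> \<ge> d' * c"
      using \<phi>(3) cos_ge[OF \<phi>(1)] c(1) d'0 by (intro mult_mono) auto
    finally show "d * cos (\<theta> d) + c * d' \<le> d' * cos (\<theta> d')"
      by (simp add: mult.commute)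
    have "\<sigma> * (d * sin (\<theta> d)) - \<sigma> * (d' * sin (\<theta> d')) = - \<sigma> * (?z \<bullet> unit_dir (\<gamma> + pi / 2))"
      using components(2)[OF polar_e] S norm_e by (simp add: inner_diff_left algebra_simps)
    also have "\<dots> = norm ?z * sin (- (\<sigma> * \<phi>))"
      unfolding components(2)[OF \<phi>(2)] by (simp add: sin_\<sigma>)
    also have "\<dots> \<ge> d' * s"
      using \<phi>(3) sin_ge[OF neg] s d'0 by (intro mult_mono) auto
    finally show "\<sigma> * (d' * sin (\<theta> d')) + s * d' \<le> \<sigma> * (d * sin (\<theta> d))"
      by (simp add: mult.commute)
  qed
  \<comment> \<open>The chain argument yields \<open>k / (2 * c)\<close>; dividing by
    \<open>sin \<beta> \<le> 1\<close> only enlarges this and produces the double angle.\<close>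
  have ratio: "k / (2 * c) \<le> sin (\<beta> - pi / 6) / sin (2 * \<beta>)"
  proof -
    have "0 < sin \<beta>"
      using beta wide pi_gt_zero by (intro sin_gt_zero) linarith+
    then have "k / (2 * c * 1) \<le> k / (2 * c * sin \<beta>)"
      using k c(1) by (intro divide_left_mono mult_left_mono mult_pos_pos) auto
    then show ?thesis
      unfolding sin_double by (simp add: k_def c_def mult_ac)
  qed
  show ?thesis
  proof (cases "A = {}")
    case True
    have "0 \<le> k / (2 * c)"
      using k c(1) by simp
    with True ratio show ?thesis
      by simp
  next
    case False
    have "2 * (real (card A) - 1) * c \<le> k"
    proof (rule chain_card_bound[where X = "\<lambda>d. d * cos (\<theta> d)" and Y = "\<lambda>d. \<sigma> * (d * sin (\<theta> d))" and s = s])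
      show "finite A"
        using A(1) fin finite_subset by blast
      fix d assume d: "d \<in> A"
      then show d0: "0 < d"
        using pos angle(3) by blast
      show "c * d \<le> d * cos (\<theta> d)"
        using cos_ge[OF wedge[OF angle(3)[OF d]]] d0 by simp
      have "cos (\<theta> d) \<le> k"
        unfolding k_cos[symmetric] cos_\<sigma>[of "\<theta> d", symmetric]
        using angle[OF d] beta by (intro cos_monotone_0_pi_le) auto
      then show "d * cos (\<theta> d) \<le> k * d"
        using d0 by simp
      show "s * d \<le> \<sigma> * (d * sin (\<theta> d))"
        using sin_ge[OF angle(1,2)[OF d]] d0 sin_\<sigma>[of "\<theta> d"] by (simp add: mult.left_commute)
      show "\<sigma> * (d * sin (\<theta> d)) \<le> d"
        using sin_le_one[of "\<sigma> * \<theta> d"] d0 sin_\<sigma>[of "\<theta> d"] by (simp add: mult.left_commute)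
    qed (use False c ks k s move in auto)
    then have "real (card A) - 1 \<le> k / (2 * c)"
      using c(1) by (simp add: field_simps)
    with ratio show ?thesis
      by linarith
  qed
qed

text \<open>The 5 is 3 + 1 + 1: at most three vectors admit only jumps, as
  \<open>2 * \<beta> < pi\<close>, and each edge contributes one plus the quotient. A vector
  admitting a step is more than 2 pi/3 away from some direction of the wedge, hence near an
  edge.\<close>

lemma card_wide:
  assumes wide: "pi / 3 < \<beta>"
  shows "int (card S) \<le> 5 + 2 * \<lfloor>sin (\<beta> - pi / 6) / sin (2 * \<beta>)\<rfloor>"
proof -
  let ?A = "{d \<in> S. jump_only d}"
  define B where "B = (\<lambda>\<sigma>. {d \<in> S. 2 * pi / 3 - \<beta> < \<sigma> * \<theta> d})"
  have cover: "S \<subseteq> ?A \<union> (B 1 \<union> B (- 1))"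
  proof
    fix d assume d: "d \<in> S"
    show "d \<in> ?A \<union> (B 1 \<union> B (- 1))"
    proof (cases "jump_only d")
      case False
      then obtain d' where "d' \<in> S" "d' < d" "norm (e d' - e d) < R"
        by (auto simp: jump_only_def)
      with d obtain \<phi> where "\<bar>\<phi>\<bar> \<le> \<beta>" "2 * pi / 3 < \<bar>\<theta> d - \<phi>\<bar>"
        using step_angle by blast
      then have "2 * pi / 3 - \<beta> < \<theta> d \<or> 2 * pi / 3 - \<beta> < - \<theta> d"
        by linarith
      with d show ?thesis
        by (auto simp: B_def)
    qed (use d in simp)
  qed
  have "card ?A \<le> 3"
    using beta by (intro card_jump_only) auto
  have side: "int (card (B \<sigma>)) \<le> 1 + \<lfloor>sin (\<beta> - pi / 6) / sin (2 * \<beta>)\<rfloor>"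
    if "\<sigma> = 1 \<or> \<sigma> = - 1" for \<sigma>
  proof -
    have "real (card (B \<sigma>)) - 1 \<le> sin (\<beta> - pi / 6) / sin (2 * \<beta>)"
      using that by (intro card_side[OF wide]) (auto simp: B_def)
    then have "int (card (B \<sigma>)) - 1 \<le> \<lfloor>sin (\<beta> - pi / 6) / sin (2 * \<beta>)\<rfloor>"
      by (simp add: le_floor_iff)
    then show ?thesis
      by simp
  qed
  have "finite (?A \<union> (B 1 \<union> B (- 1)))"
    using fin by (simp add: B_def)
  then have "card S \<le> card (?A \<union> (B 1 \<union> B (- 1)))"
    using cover by (rule card_mono)
  also have "\<dots> \<le> card ?A + (card (B 1) + card (B (- 1)))"
    by (intro order_trans[OF card_Un_le] add_mono card_Un_le order_refl)
  finally show ?thesis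
    using \<open>card ?A \<le> 3\<close> side[of 1] side[of "- 1"] by simp
qed

end

section \<open>Sliding windows\<close>

text \<open>\<open>h\<close> is half the arclength. Membership is bounded from outside by the closed
  sector and from inside by the open one, so both kinds of half-open arc fit.\<close>

locale wide_cone =
  fixes C :: "(real^2) set" and \<gamma> h :: real
  assumes C_polar: "\<And>x. x \<in> C \<Longrightarrow> x \<noteq> 0 \<and> (\<exists>\<theta>. \<bar>\<theta>\<bar> \<le> h \<and> x = norm x *\<^sub>R unit_dir (\<gamma> + \<theta>))"
    and C_interior: "\<And>r \<theta>. 0 < r \<Longrightarrow> \<bar>\<theta>\<bar> < h \<Longrightarrow> r *\<^sub>R unit_dir (\<gamma> + \<theta>) \<in> C"
    and h: "pi / 2 < h" "h \<le> pi"
begin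

lemma nonzero_if_in_C: "x \<in> C \<Longrightarrow> x \<noteq> 0"
  using C_polar by blast

text \<open>Since \<open>h\<close> exceeds pi/2 strictly, the open sector and its negative already
  cover all directions.\<close>

lemma in_C_or_minus:
  assumes "x \<noteq> 0"
  shows "x \<in> C \<or> - x \<in> C"
proof -
  obtain \<theta> where \<theta>: "\<gamma> - h \<le> \<theta>" "\<theta> < \<gamma> - h + 2 * pi" "x = norm x *\<^sub>R unit_dir \<theta>"
    using polar_form[of "\<gamma> - h" x] .
  have nx: "0 < norm x"
    using assms by simp
  consider "\<bar>\<theta> - \<gamma>\<bar> < h" | "\<bar>\<theta> + pi - \<gamma>\<bar> < h" | "\<bar>\<theta> - pi - \<gamma>\<bar> < h"
    using \<theta>(1,2) h by linarith
  then show ?thesis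
  proof cases
    case 1
    then show ?thesis
      using C_interior[OF nx 1] \<theta>(3) by simp
  next
    case 2
    then show ?thesis
      using C_interior[OF nx 2] \<theta>(3) by (simp add: unit_dir_shift)
  next
    case 3
    then show ?thesis
      using C_interior[OF nx 3] \<theta>(3) by (simp add: unit_dir_shift)
  qed
qed

text \<open>The direction of \<open>- x\<close> avoids the open sector, so it is within
  \<open>pi - h\<close> of the direction opposite to the axis.\<close>

lemma one_sided_wedge:
  assumes "x \<in> C" "- x \<notin> C"
  obtains \<theta> where "\<bar>\<theta>\<bar> \<le> pi - h" "x = norm x *\<^sub>R unit_dir (\<gamma> + \<theta>)"
proof -
  obtain \<theta> where \<theta>: "\<bar>\<theta>\<bar> \<le> h" "x = norm x *\<^sub>R unit_dir (\<gamma> + \<theta>)"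
    using C_polar assms(1) by blast
  have nx: "0 < norm x"
    using nonzero_if_in_C[OF assms(1)] by simp
  have minus: "- x = norm x *\<^sub>R unit_dir (\<gamma> + (\<theta> + pi))" "- x = norm x *\<^sub>R unit_dir (\<gamma> + (\<theta> - pi))"
    using \<theta>(2) unit_dir_shift[of "\<gamma> + \<theta>"] by (metis add.assoc add_diff_eq scaleR_minus_right)+
  have "\<not> \<bar>\<theta> + pi\<bar> < h" "\<not> \<bar>\<theta> - pi\<bar> < h"
    using C_interior[OF nx] assms(2) minus by metis+
  then have "\<bar>\<theta>\<bar> \<le> pi - h"
    using \<theta>(1) h by linarith
  with \<theta>(2) that show thesis
    by blast
qed

end

text \<open>\<open>T t x\<close> stands for \<open>x \<in> t \<alpha> + L\<close>, and with \<open>a = n - 1\<close>, \<open>M = N - 1\<close> the admissible times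
  \<open>m - n\<close> form the window \<open>[-a, M - a]\<close>.\<close>

locale direction_gaps = wide_cone C \<gamma> h for C :: "(real^2) set" and \<gamma> h :: real +
  fixes T :: "int \<Rightarrow> real^2 \<Rightarrow> bool" and M :: int and \<delta> :: "int \<Rightarrow> real"
  assumes T_diff: "\<And>s t x y. T s x \<Longrightarrow> T t y \<Longrightarrow> T (s - t) (x - y)"
    and attained: "\<And>a. 0 \<le> a \<Longrightarrow> a \<le> M \<Longrightarrow>
      \<exists>t x. T t x \<and> x \<in> C \<and> - a \<le> t \<and> t \<le> M - a \<and> norm x = \<delta> a"
    and minimal: "\<And>a t x. 0 \<le> a \<Longrightarrow> a \<le> M \<Longrightarrow> T t x \<Longrightarrow> x \<in> C \<Longrightarrow> - a \<le> t \<Longrightarrow> t \<le> M - a \<Longrightarrow>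
      \<delta> a \<le> norm x"
begin

lemma T_minus: "T t x \<Longrightarrow> T (- t) (- x)"
  using T_diff[of t x t x] T_diff[of 0 0 t x] by simp

text \<open>Reversing time exchanges the windows of \<open>a\<close> and \<open>M - a\<close>; this
  justifies the normalisation \<open>M \<le> 2 * A\<close> made later.\<close>

lemma reflected: "direction_gaps C \<gamma> h (\<lambda>t. T (- t)) M (\<lambda>a. \<delta> (M - a))"
proof unfold_locales
  show "T (- (s - t)) (x - y)" if "T (- s) x" "T (- t) y" for s t x y
    using T_diff[OF that] by simp
  show "\<exists>t x. T (- t) x \<and> x \<in> C \<and> - a \<le> t \<and> t \<le> M - a \<and> norm x = \<delta> (M - a)" if a: "0 \<le> a" "a \<le> M" for a
  proof -
    obtain t x where "T t x" "x \<in> C" "- (M - a) \<le> t" "t \<le> M - (M - a)" "norm x = \<delta> (M - a)"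
      using attained[of "M - a"] a by auto
    then show ?thesis
      by (intro exI[of _ "- t"] exI[of _ x]) auto
  qed
  show "\<delta> (M - a) \<le> norm x" if "0 \<le> a" "a \<le> M" "T (- t) x" "x \<in> C" "- a \<le> t" "t \<le> M - a" for a t x
    using minimal[of "M - a" "- t" x] that by auto
qed

end

text \<open>\<open>M - A\<close> is the J of the overview; \<open>M \<le> 2 * A\<close> says that
  the window reaches at least as far into negative times as into positive ones.\<close>

locale peak_window = direction_gaps +
  fixes A :: int
  assumes A: "0 \<le> A" "A \<le> M" "M \<le> 2 * A"
    and peak: "\<And>a. 0 \<le> a \<Longrightarrow> a \<le> M \<Longrightarrow> \<delta> a \<le> \<delta> A"
begin

abbreviation R :: real where "R \<equiv> \<delta> A"

text \<open>\<open>u\<close> may be any vector at that time, inside the cone or not: a minimizer at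
  a time below \<open>- A\<close> is recorded through its negative.\<close>

definition outer_values :: "real set" where
  "outer_values = {d \<in> \<delta> ` {0..M}. d < R \<and> (\<exists>t u. A < t \<and> t \<le> M \<and> T t u \<and> norm u = d)}"

definition early_values :: "real set" where
  "early_values = {d \<in> \<delta> ` {0..M}. d < R \<and> d \<notin> outer_values}"

lemma value_cases: "\<delta> ` {0..M} \<subseteq> insert R (outer_values \<union> early_values)"
  using peak by (force simp: early_values_def)

lemma finite_values: "finite outer_values" "finite early_values"
  by (simp_all add: outer_values_def early_values_def)

lemma window: "T t x \<Longrightarrow> x \<in> C \<Longrightarrow> - A \<le> t \<Longrightarrow> t \<le> M - A \<Longrightarrow> R \<le> norm x"
  using minimal A by blast

text \<open>As \<open>M - A \<le> A\<close>, both \<open>t\<close> and \<open>- t\<close> lie in the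
  peak window, and one of \<open>x\<close>, \<open>- x\<close> lies in the cone.\<close>

lemma two_sided_window:
  assumes "T t x" "x \<noteq> 0" "\<bar>t\<bar> \<le> M - A"
  shows "R \<le> norm x"
  using in_C_or_minus[OF assms(2)]
proof
  assume "x \<in> C"
  with assms A show ?thesis
    by (intro window[of t]) auto
next
  assume "- x \<in> C"
  with assms A T_minus[of t x] window[of "- t" "- x"] show ?thesis
    by auto
qed

lemma outer_separated:
  assumes "T t u" "A < t" "t \<le> M" "T t' u'" "A < t'" "t' \<le> M" "u \<noteq> u'"
  shows "R \<le> norm (u - u')"
  using assms by (intro two_sided_window[OF T_diff[OF assms(1,4)]]) auto

text \<open>Times in (A, M] differ by less than \<open>M - A\<close>, so vectors chosen for distinct
  values are at distance at least \<open>R\<close> and the packing bound applies.\<close>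

lemma card_outer_values: "card outer_values \<le> 5"
proof -
  have "\<forall>d\<in>outer_values. \<exists>u. norm u = d \<and> (\<exists>t. A < t \<and> t \<le> M \<and> T t u)"
    by (auto simp: outer_values_def)
  then obtain u where u: "\<And>d. d \<in> outer_values \<Longrightarrow> norm (u d) = d \<and> (\<exists>t. A < t \<and> t \<le> M \<and> T t (u d))"
    by metis
  show ?thesis
  proof (rule separated_vectors_card[of _ u R])
    show "norm (u d) < R" if "d \<in> outer_values" for d
      using u[OF that] that by (simp add: outer_values_def)
    show "R \<le> norm (u d - u d')" if "d \<in> outer_values" "d' \<in> outer_values" "d \<noteq> d'" for d d'
    proof -
      have "u d \<noteq> u d'"
        using u that by metis
      then show ?thesis
        using u that outer_separated by blast
    qed
  qed (rule finite_values)
qed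

text \<open>A minimizer at a time beyond \<open>A\<close> in absolute value would make
  \<open>d\<close> outer, and one in the peak window would not be shorter than \<open>R\<close>. For
  the remaining times \<open>- t\<close> is in the peak window, which keeps \<open>- x\<close> out
  of the cone.\<close>

lemma early_value:
  assumes "d \<in> early_values"
  obtains a t x where "0 \<le> a" "a \<le> M" "\<delta> a = d" "T t x" "norm x = d" "x \<in> C" "- x \<notin> C"
    "0 \<le> t" "t \<le> A" "t \<le> M - a" "M - A < t"
proof -
  obtain a where a: "0 \<le> a" "a \<le> M" "\<delta> a = d" and "d < R"
    using assms by (auto simp: early_values_def)
  obtain t x where tx: "T t x" "x \<in> C" "- a \<le> t" "t \<le> M - a" "norm x = d"
    using attained[OF a(1,2)] a(3) by auto
  have not_outer: "\<not> (A < s \<and> s \<le> M \<and> T s u)" if "norm u = d" for s u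
    using assms that by (auto simp: early_values_def outer_values_def)
  have "\<not> t < - A"
    using not_outer[of "- x" "- t"] T_minus[OF tx(1)] tx a by auto
  moreover have "\<not> (- A \<le> t \<and> t \<le> M - A)"
    using window[OF tx(1,2)] \<open>d < R\<close> tx(5) by auto
  ultimately have t: "M - A < t"
    by linarith
  have "t \<le> A"
    using not_outer[of x t] tx a by fastforce
  moreover have "- x \<notin> C"
    using window[OF T_minus[OF tx(1)]] \<open>d < R\<close> tx(5) t \<open>t \<le> A\<close> A by auto
  ultimately show thesis
    using that a tx t A by simp
qed

lemma early_records:
  obtains e \<theta> where "wedge_records early_values \<gamma> (pi - h) R e \<theta>"
proof -
  define rep where "rep = (\<lambda>d a t x. 0 \<le> a \<and> a \<le> M \<and> \<delta> a = d \<and> T t x \<and> norm x = d \<and> x \<in> C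
    \<and> 0 \<le> t \<and> t \<le> A \<and> t \<le> M - a \<and> M - A < t)"
  have "\<exists>a t x \<theta>. rep d a t x \<and> \<bar>\<theta>\<bar> \<le> pi - h \<and> x = norm x *\<^sub>R unit_dir (\<gamma> + \<theta>)"
    if "d \<in> early_values" for d
    using early_value[OF that] one_sided_wedge unfolding rep_def by metis
  then obtain a t e \<theta> where rep: "\<And>d. d \<in> early_values \<Longrightarrow> rep d (a d) (t d) (e d)"
    and \<theta>: "\<And>d. d \<in> early_values \<Longrightarrow> \<bar>\<theta> d\<bar> \<le> pi - h"
      "\<And>d. d \<in> early_values \<Longrightarrow> e d = norm (e d) *\<^sub>R unit_dir (\<gamma> + \<theta> d)"
    by metis
  have "wedge_records early_values \<gamma> (pi - h) R e \<theta>"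
  proof
    show "0 < d" "norm (e d) = d" if "d \<in> early_values" for d
      using rep[OF that] nonzero_if_in_C unfolding rep_def by (metis zero_less_norm_iff)+
    show "d < R" if "d \<in> early_values" for d
      using that by (simp add: early_values_def)
    fix d d' assume S: "d \<in> early_values" "d' \<in> early_values" and less: "d' < d"
      and small: "norm (e d' - e d) < R"
    let ?z = "e d' - e d" and ?t = "t d' - t d"
    note r = rep[OF S(1), unfolded rep_def] and r' = rep[OF S(2), unfolded rep_def]
    \<comment> \<open>Within the window of \<open>a d\<close> the shorter vector \<open>e d'\<close>
      would contradict minimality; its time is nonnegative, so it lies past the right end.\<close>
    have "\<not> t d' \<le> M - a d"
      using minimal[of "a d" "t d'" "e d'"] r r' less by auto
    then have later: "0 < ?t"
      using r by linarith
    have T: "T ?t ?z"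
      using r r' by (intro T_diff) auto
    \<comment> \<open>\<open>- ?t\<close> lies in the peak window, so a cone vector there could not
      be shorter than \<open>R\<close>.\<close>
    have "- ?z \<notin> C"
      using window[OF T_minus[OF T]] small later r r' A by (auto simp: norm_minus_commute)
    moreover have "?z \<noteq> 0"
      using less r r' by auto
    ultimately have "?z \<in> C"
      using in_C_or_minus by blast
    \<comment> \<open>\<open>?t\<close> lies between 0 and \<open>t d'\<close>, hence in the window
      of \<open>a d'\<close>.\<close>
    moreover from this have "d' \<le> norm ?z"
      using minimal[of "a d'" ?t ?z] T r r' later by auto
    ultimately show "d' \<le> norm ?z \<and> (\<exists>\<phi>. \<bar>\<phi>\<bar> \<le> pi - h \<and> ?z = norm ?z *\<^sub>R unit_dir (\<gamma> + \<phi>))"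
      using one_sided_wedge[of ?z] \<open>- ?z \<notin> C\<close> by metis
  qed (use \<theta> h finite_values in auto)
  then show thesis
    by (rule that)
qed

section \<open>Counting the values\<close>

lemma card_values_le: "card (\<delta> ` {0..M}) \<le> 1 + card outer_values + card early_values"
proof -
  have "card (\<delta> ` {0..M}) \<le> card (insert R (outer_values \<union> early_values))"
    using value_cases finite_values by (intro card_mono) auto
  also have "\<dots> \<le> Suc (card (outer_values \<union> early_values))"
    by (rule card_insert_le_m1) simp_all
  also have "\<dots> \<le> Suc (card outer_values + card early_values)"
    using card_Un_le by blast
  finally show ?thesis
    by simp
qed

lemma card_values_narrow:
  assumes "2 * pi / 3 \<le> h"
  shows "card (\<delta> ` {0..M}) \<le> 8"
proof -
  obtain e \<theta> where "wedge_records early_values \<gamma> (pi - h) R e \<theta>"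
    by (rule early_records)
  then have "card early_values \<le> 2"
    using assms by (intro wedge_records.card_narrow) auto
  with card_values_le card_outer_values show ?thesis
    by linarith
qed

lemma card_values_wide:
  assumes "h < 2 * pi / 3"
  shows "int (card (\<delta> ` {0..M})) \<le> 11 + 2 * \<lfloor>sin (h + pi / 6) / sin (2 * h - pi)\<rfloor>"
proof -
  obtain e \<theta> where "wedge_records early_values \<gamma> (pi - h) R e \<theta>"
    by (rule early_records)
  then have "int (card early_values) \<le> 5 + 2 * \<lfloor>sin (pi - h - pi / 6) / sin (2 * (pi - h))\<rfloor>"
    using assms by (intro wedge_records.card_wide) auto
  moreover have "sin (pi - h - pi / 6) = sin (h + pi / 6)"
    using sin_pi_minus[of "h + pi / 6"] by (simp only: diff_diff_eq)
  moreover have "sin (2 * (pi - h)) = sin (2 * h - pi)"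
    by (simp add: right_diff_distrib sin_diff)
  ultimately show ?thesis
    using card_values_le card_outer_values by simp
qed

lemma card_values_full:
  assumes full: "\<And>x. x \<noteq> 0 \<Longrightarrow> x \<in> C"
  shows "card (\<delta> ` {0..M}) \<le> 5"
proof -
  have "early_values = {}"
    using early_value full nonzero_if_in_C by (metis equals0I neg_equal_0_iff_equal)
  moreover have "card outer_values \<le> 4"
  proof (rule ccontr)
    assume "\<not> card outer_values \<le> 4"
    \<comment> \<open>Each outer value is represented at the earliest time beyond \<open>A\<close>
      at which its length occurs; this choice makes the comparison at earlier times strict.\<close>
    define cand where "cand = (\<lambda>d n. A < int n \<and> int n \<le> M \<and> (\<exists>u. T (int n) u \<and> norm u = d))"
    define \<tau> where "\<tau> = (\<lambda>d. LEAST n. cand d n)"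
    have "\<exists>n. cand d n" if d: "d \<in> outer_values" for d
    proof -
      obtain t u where "A < t" "t \<le> M" "T t u" "norm u = d"
        using d by (auto simp: outer_values_def)
      with A(1) have "cand d (nat t)"
        by (auto simp: cand_def)
      then show ?thesis ..
    qed
    then have cand_\<tau>: "cand d (\<tau> d)" if "d \<in> outer_values" for d
      unfolding \<tau>_def by (rule LeastI_ex) (rule that)
    define u where "u = (\<lambda>d. SOME u. T (int (\<tau> d)) u \<and> norm u = d)"
    have u: "T (int (\<tau> d)) (u d)" "norm (u d) = d" "A < int (\<tau> d)" "int (\<tau> d) \<le> M"
      if "d \<in> outer_values" for d
    proof -
      have "\<exists>u. T (int (\<tau> d)) u \<and> norm u = d"
        using cand_\<tau>[OF that] unfolding cand_def by blast
      from someI_ex[OF this] show "T (int (\<tau> d)) (u d)" "norm (u d) = d"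
        unfolding u_def by simp_all
      show "A < int (\<tau> d)" "int (\<tau> d) \<le> M"
        using cand_\<tau>[OF that] unfolding cand_def by simp_all
    qed
    have far: "A < \<bar>s\<bar>" if "T s x" "x \<noteq> 0" "norm x < R" for s x
    proof (rule ccontr)
      assume "\<not> A < \<bar>s\<bar>"
      then have "(- A \<le> s \<and> s \<le> M - A) \<or> (- A \<le> - s \<and> - s \<le> M - A)"
        using A by linarith
      with window[OF that(1)] window[OF T_minus[OF that(1)]] full[of x] full[of "- x"] that show False
        by auto
    qed
    have pos_if: "0 < d" if "d \<in> outer_values" for d
    proof -
      obtain a where "0 \<le> a" "a \<le> M" "\<delta> a = d"
        using \<open>d \<in> outer_values\<close> by (auto simp: outer_values_def)
      then show ?thesis
        using attained[of a] nonzero_if_in_C by (metis zero_less_norm_iff)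
    qed
    \<comment> \<open>A minimizer for \<open>d\<close> sits at a time \<open>t\<close> with
      \<open>\<bar>t\<bar> \<ge> \<tau> d\<close>. The window contains 0 and \<open>t\<close>, hence
      also \<open>s\<close> or \<open>- s\<close> whenever
      \<open>\<bar>s\<bar> \<le> \<bar>t\<bar>\<close>.\<close>
    have least_at: "d \<le> norm x" "\<bar>s\<bar> < int (\<tau> d) \<Longrightarrow> d < norm x"
      if d: "d \<in> outer_values" and x: "T s x" "x \<noteq> 0" "\<bar>s\<bar> \<le> int (\<tau> d)" for d s x
    proof -
      obtain a where a: "0 \<le> a" "a \<le> M" "\<delta> a = d" and "d < R"
        using d by (auto simp: outer_values_def)
      obtain t y where ty: "T t y" "y \<in> C" "- a \<le> t" "t \<le> M - a" "norm y = d"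
        using attained[OF a(1,2)] a(3) by auto
      have "A < \<bar>t\<bar>"
        using far[OF ty(1)] ty nonzero_if_in_C \<open>d < R\<close> by auto
      moreover have "T \<bar>t\<bar> (if 0 \<le> t then y else - y)"
        using ty(1) T_minus[OF ty(1)] by auto
      ultimately have "cand d (nat \<bar>t\<bar>)"
        unfolding cand_def using ty a by (auto intro!: exI[of _ "if 0 \<le> t then y else - y"])
      then have "int (\<tau> d) \<le> \<bar>t\<bar>"
        unfolding \<tau>_def by (metis Least_le abs_ge_zero int_nat_eq of_nat_le_iff)
      then have "\<bar>s\<bar> \<le> \<bar>t\<bar>"
        using x(3) by simp
      then have "(- a \<le> s \<and> s \<le> M - a) \<or> (- a \<le> - s \<and> - s \<le> M - a)"
        using ty(3,4) a by linarith
      then show le: "d \<le> norm x"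
        using minimal[OF a(1,2) x(1)] minimal[OF a(1,2) T_minus[OF x(1)]] full[of x] full[of "- x"] x(2) a(3)
        by auto
      show "d < norm x" if s: "\<bar>s\<bar> < int (\<tau> d)"
      proof (rule ccontr)
        assume "\<not> d < norm x"
        with le have eq: "norm x = d"
          by simp
        then have "A < \<bar>s\<bar>"
          using far[OF x(1,2)] \<open>d < R\<close> by simp
        moreover have "T \<bar>s\<bar> (if 0 \<le> s then x else - x)"
          using x(1) T_minus[OF x(1)] by auto
        ultimately have "cand d (nat \<bar>s\<bar>)"
          unfolding cand_def using eq s u(4)[OF d] by (auto intro!: exI[of _ "if 0 \<le> s then x else - x"])
        then have "int (\<tau> d) \<le> \<bar>s\<bar>"
          unfolding \<tau>_def by (metis Least_le abs_ge_zero int_nat_eq of_nat_le_iff)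
        with s show False
          by simp
      qed
    qed
    define w where "w = Min outer_values"
    have "outer_values \<noteq> {}"
      using \<open>\<not> card outer_values \<le> 4\<close> by auto
    then have w: "w \<in> outer_values" "\<And>d. d \<in> outer_values \<Longrightarrow> w \<le> d"
      using finite_values(1) unfolding w_def by simp_all
    have short: "norm (u d) < R" if "d \<in> outer_values" for d
      using u(2)[OF that] that by (simp add: outer_values_def)
    have sep: "R \<le> norm (u d - u d')" if "d \<in> outer_values" "d' \<in> outer_values" "d \<noteq> d'" for d d'
    proof -
      have "u d \<noteq> u d'"
        using u(2) that by metis
      then show ?thesis
        using u[OF that(1)] u[OF that(2)] outer_separated by blast
    qed
    obtain p q where pq: "p \<in> outer_values" "q \<in> outer_values" "p \<noteq> w" "q \<noteq> w" "p \<noteq> q"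
      "norm (u p + u q - u w) \<le> max (norm (u p)) (norm (u q))"
      using five_separated_vectors[of outer_values w u R] finite_values(1) \<open>\<not> card outer_values \<le> 4\<close>
        w short sep u(2) by auto
    have later: "\<tau> d < \<tau> w" if "d \<in> outer_values" "d \<noteq> w" for d
    proof (rule ccontr)
      assume "\<not> \<tau> d < \<tau> w"
      then have "d \<le> norm (u w)"
        using least_at(1)[OF that(1) u(1)[OF w(1)]] pos_if[OF w(1)] u(2)[OF w(1)] by force
      with w(2)[OF that(1)] that(2) u(2)[OF w(1)] show False
        by simp
    qed
    define s where "s = int (\<tau> p) + int (\<tau> q) - int (\<tau> w)"
    \<comment> \<open>Two outer times differ by less than \<open>M - A \<le> A\<close>, which is
      below every outer time, so \<open>s\<close> is positive; it is smaller than the other two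
      times because \<open>\<tau> w\<close> is the latest.\<close>
    have s: "\<bar>s\<bar> < int (\<tau> p)" "\<bar>s\<bar> < int (\<tau> q)"
      using later[OF pq(1,3)] later[OF pq(2,4)] u(3,4)[OF w(1)] u(3)[OF pq(1)] u(3)[OF pq(2)] A
      unfolding s_def by linarith+
    have T: "T s (u p + u q - u w)"
      using T_diff[OF T_diff[OF u(1)[OF pq(1)] u(1)[OF w(1)]] T_minus[OF u(1)[OF pq(2)]]]
      by (simp add: s_def algebra_simps)
    have nonzero: "u p + u q - u w \<noteq> 0"
    proof
      assume "u p + u q - u w = 0"
      then have "u p - u w = - u q"
        by (metis add.commute add_diff_eq eq_neg_iff_add_eq_0)
      then show False
        using sep[OF pq(1) w(1) pq(3)] short[OF pq(2)] by simp
    qed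
    have "p < norm (u p + u q - u w)" "q < norm (u p + u q - u w)"
      using least_at(2)[OF pq(1) T nonzero] least_at(2)[OF pq(2) T nonzero] s by auto
    then show False
      using pq(6) u(2)[OF pq(1)] u(2)[OF pq(2)] by (simp add: max_def split: if_splits)
  qed
  ultimately show ?thesis
    using card_values_le by simp
qed

end

section \<open>Lattices and cones\<close>

text \<open>If the maximum occurs at an index below \<open>M / 2\<close>, reflection moves it to
  \<open>M - A\<close> without changing the set of values.\<close>

lemma (in direction_gaps) peak_window_exists:
  assumes "0 \<le> M"
  shows "\<exists>T' \<delta>' A. peak_window C \<gamma> h T' M \<delta>' A \<and> \<delta>' ` {0..M} = \<delta> ` {0..M}"
proof -
  have "Max (\<delta> ` {0..M}) \<in> \<delta> ` {0..M}"
    using assms by (intro Max_in) auto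
  then obtain A where A: "0 \<le> A" "A \<le> M" "\<delta> A = Max (\<delta> ` {0..M})"
    by auto
  then have peak: "\<delta> a \<le> \<delta> A" if "0 \<le> a" "a \<le> M" for a
    using that by simp
  show ?thesis
  proof (cases "M \<le> 2 * A")
    case True
    then have "peak_window C \<gamma> h T M \<delta> A"
      using A peak by unfold_locales auto
    then show ?thesis by blast
  next
    case False
    interpret r: direction_gaps C \<gamma> h "\<lambda>t. T (- t)" M "\<lambda>a. \<delta> (M - a)"
      by (rule reflected)
    have "peak_window C \<gamma> h (\<lambda>t. T (- t)) M (\<lambda>a. \<delta> (M - a)) (M - A)"
      using A peak False by unfold_locales auto
    moreover have "(\<lambda>a. \<delta> (M - a)) ` {0..M} = \<delta> ` {0..M}"
    proof -
      have "(\<lambda>a. M - a) ` {0..M} = {0..M}"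
        by (auto intro!: image_eqI[of x _ "M - x" for x])
      then show ?thesis
        by (metis image_image)
    qed
    ultimately show ?thesis by blast
  qed
qed

section \<open>Unimodular lattices\<close>

lemma unimodular_lattice_diff:
  assumes "unimodular_lattice L" "x \<in> L" "y \<in> L"
  shows "x - y \<in> L"
proof -
  obtain b1 b2 where L: "L = {of_int m1 *\<^sub>R b1 + of_int m2 *\<^sub>R b2 | m1 m2. True}"
    using assms(1) unfolding unimodular_lattice_def by blast
  obtain m1 m2 n1 n2 where "x = of_int m1 *\<^sub>R b1 + of_int m2 *\<^sub>R b2" "y = of_int n1 *\<^sub>R b1 + of_int n2 *\<^sub>R b2"
    using assms(2,3) unfolding L by blast
  then have "x - y = of_int (m1 - n1) *\<^sub>R b1 + of_int (m2 - n2) *\<^sub>R b2"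
    by (simp add: algebra_simps)
  then show ?thesis
    unfolding L by blast
qed

lemma unimodular_lattice_nonzero:
  assumes "unimodular_lattice L"
  shows "\<exists>x\<in>L. x \<noteq> 0"
proof -
  obtain b1 b2 :: "real^2" where b: "\<bar>b1$1 * b2$2 - b1$2 * b2$1\<bar> = 1"
    and L: "L = {of_int m1 *\<^sub>R b1 + of_int m2 *\<^sub>R b2 | m1 m2. True}"
    using assms unfolding unimodular_lattice_def by blast
  have "b1 \<noteq> 0"
    using b by auto
  moreover have "b1 = of_int 1 *\<^sub>R b1 + of_int 0 *\<^sub>R b2"
    by simp
  then have "b1 \<in> L"
    unfolding L by blast
  ultimately show ?thesis
    by blast
qed

text \<open>Cramer's rule with determinant 1 or -1: up to sign, the integer coefficients of
  \<open>x\<close> are its determinants with the basis vectors, and the norm of \<open>x\<close>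
  bounds these.\<close>

lemma unimodular_lattice_finite_ball:
  assumes "unimodular_lattice L"
  shows "finite {x \<in> L. norm x \<le> B}"
proof -
  obtain b1 b2 :: "real^2" where b: "\<bar>b1$1 * b2$2 - b1$2 * b2$1\<bar> = 1"
    and L: "L = {of_int m1 *\<^sub>R b1 + of_int m2 *\<^sub>R b2 | m1 m2. True}"
    using assms unfolding unimodular_lattice_def by blast
  define K where "K = (\<lambda>b::real^2. \<lceil>B * (\<bar>b$1\<bar> + \<bar>b$2\<bar>)\<rceil>)"
  have cross: "\<bar>x$1 * b$2 - x$2 * b$1\<bar> \<le> B * (\<bar>b$1\<bar> + \<bar>b$2\<bar>)" if "norm x \<le> B" for x b :: "real^2"
  proof -
    have "\<bar>x$1\<bar> \<le> B" "\<bar>x$2\<bar> \<le> B"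
      using component_le_norm_cart[of x 1] component_le_norm_cart[of x 2] that by linarith+
    then have "\<bar>x$1\<bar> * \<bar>b$2\<bar> \<le> B * \<bar>b$2\<bar>" "\<bar>x$2\<bar> * \<bar>b$1\<bar> \<le> B * \<bar>b$1\<bar>"
      by (intro mult_right_mono; simp)+
    then show ?thesis
      using abs_triangle_ineq4[of "x$1 * b$2" "x$2 * b$1"] by (simp add: abs_mult algebra_simps)
  qed
  have coeff: "m \<in> {- K b..K b}" if "\<bar>real_of_int m\<bar> \<le> B * (\<bar>b$1\<bar> + \<bar>b$2\<bar>)" for m and b :: "real^2"
    using that unfolding K_def by (simp add: abs_le_iff) linarith
  have "{x \<in> L. norm x \<le> B}
      \<subseteq> (\<lambda>(m1, m2). of_int m1 *\<^sub>R b1 + of_int m2 *\<^sub>R b2) ` ({- K b2..K b2} \<times> {- K b1..K b1})"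
  proof
    fix x assume x: "x \<in> {x \<in> L. norm x \<le> B}"
    then obtain m1 m2 where m: "x = of_int m1 *\<^sub>R b1 + of_int m2 *\<^sub>R b2"
      unfolding L by blast
    have "x$1 * b2$2 - x$2 * b2$1 = of_int m1 * (b1$1 * b2$2 - b1$2 * b2$1)"
      "x$1 * b1$2 - x$2 * b1$1 = - of_int m2 * (b1$1 * b2$2 - b1$2 * b2$1)"
      unfolding m by (simp_all add: algebra_simps)
    then have "\<bar>x$1 * b2$2 - x$2 * b2$1\<bar> = \<bar>real_of_int m1\<bar>" "\<bar>x$1 * b1$2 - x$2 * b1$1\<bar> = \<bar>real_of_int m2\<bar>"
      using b by (simp_all add: abs_mult)
    then have "m1 \<in> {- K b2..K b2}" "m2 \<in> {- K b1..K b1}"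
      using x cross[of x b2] cross[of x b1] by (intro coeff; simp)+
    with m show "x \<in> (\<lambda>(m1, m2). of_int m1 *\<^sub>R b1 + of_int m2 *\<^sub>R b2) ` ({- K b2..K b2} \<times> {- K b1..K b1})"
      by (intro image_eqI[of _ _ "(m1, m2)"]) auto
  qed
  then show ?thesis
    by (rule finite_subset) simp
qed

section \<open>Passing from the definitions to times and cones\<close>

definition shifted_lattice :: "real^2 \<Rightarrow> (real^2) set \<Rightarrow> int \<Rightarrow> real^2 \<Rightarrow> bool" where
  "shifted_lattice \<alpha> L t x \<longleftrightarrow> x - of_int t *\<^sub>R \<alpha> \<in> L"

definition direction_cone :: "(real^2) set \<Rightarrow> (real^2) set" where
  "direction_cone D = {r *\<^sub>R u | r u. 0 < r \<and> u \<in> D}"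

lemma nn_dist_eq:
  "nn_dist D \<alpha> L N n = Inf {norm x | x. x \<in> direction_cone D \<and>
     (\<exists>t. 1 - int n \<le> t \<and> t \<le> int N - int n \<and> shifted_lattice \<alpha> L t x)}"
proof -
  have "{norm ((real m - real n) *\<^sub>R \<alpha> + l) | m l. 1 \<le> m \<and> m \<le> N \<and> l \<in> L \<and>
      (\<exists>r>0. \<exists>u\<in>D. (real m - real n) *\<^sub>R \<alpha> + l = r *\<^sub>R u)}
    = {norm x | x. x \<in> direction_cone D \<and>
     (\<exists>t. 1 - int n \<le> t \<and> t \<le> int N - int n \<and> shifted_lattice \<alpha> L t x)}" (is "?lhs = ?rhs")
  proof
    show "?lhs \<subseteq> ?rhs"
    proof
      fix d assume "d \<in> ?lhs"
      then obtain m l where d: "d = norm ((real m - real n) *\<^sub>R \<alpha> + l)" and m: "1 \<le> m" "m \<le> N" "l \<in> L"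
        and C: "(real m - real n) *\<^sub>R \<alpha> + l \<in> direction_cone D"
        unfolding direction_cone_def by blast
      have "shifted_lattice \<alpha> L (int m - int n) ((real m - real n) *\<^sub>R \<alpha> + l)"
        using m by (simp add: shifted_lattice_def)
      moreover have "1 - int n \<le> int m - int n" "int m - int n \<le> int N - int n"
        using m by simp_all
      ultimately show "d \<in> ?rhs"
        using d C by blast
    qed
    show "?rhs \<subseteq> ?lhs"
    proof
      fix d assume "d \<in> ?rhs"
      then obtain x t where d: "d = norm x" and C: "x \<in> direction_cone D"
        and t: "1 - int n \<le> t" "t \<le> int N - int n" and l: "x - of_int t *\<^sub>R \<alpha> \<in> L"
        unfolding shifted_lattice_def by blast
      define m where "m = nat (t + int n)"
      have m: "1 \<le> m" "m \<le> N" "real m - real n = of_int t"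
        using t by (auto simp: m_def)
      have x: "x = (real m - real n) *\<^sub>R \<alpha> + (x - of_int t *\<^sub>R \<alpha>)"
        using m(3) by simp
      from C obtain r u where "0 < r" "u \<in> D" "x = r *\<^sub>R u"
        unfolding direction_cone_def by blast
      with d m(1,2) l x show "d \<in> ?lhs"
        by (intro CollectI exI[of _ m] exI[of _ "x - of_int t *\<^sub>R \<alpha>"]) auto
    qed
  qed
  then show ?thesis
    unfolding nn_dist_def by simp
qed

lemma half_open_arc_cone:
  assumes "half_open_arc D tau"
  obtains \<gamma> where
    "\<And>x. x \<in> direction_cone D \<Longrightarrow> x \<noteq> 0 \<and> (\<exists>\<theta>. \<bar>\<theta>\<bar> \<le> tau / 2 \<and> x = norm x *\<^sub>R unit_dir (\<gamma> + \<theta>))"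
    "\<And>r \<theta>. 0 < r \<Longrightarrow> \<bar>\<theta>\<bar> < tau / 2 \<Longrightarrow> r *\<^sub>R unit_dir (\<gamma> + \<theta>) \<in> direction_cone D"
proof -
  obtain a where a: "D = unit_dir ` {a..<a + tau} \<or> D = unit_dir ` {a<..a + tau}"
    using assms unfolding half_open_arc_def by blast
  \<comment> \<open>Both kinds of half-open arc lie between the open and the closed arc; the axis
    chosen below is the midpoint \<open>a + tau / 2\<close>.\<close>
  have up: "D \<subseteq> unit_dir ` {a..a + tau}" and low: "unit_dir ` {a<..<a + tau} \<subseteq> D"
    using a by (elim disjE; force)+
  show thesis
  proof
    fix x assume "x \<in> direction_cone D"
    then obtain r t where x: "x = r *\<^sub>R unit_dir t" "0 < r" "a \<le> t" "t \<le> a + tau"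
      using up unfolding direction_cone_def by force
    have "norm x = r"
      using x by simp
    moreover from this have "x \<noteq> 0"
      using x(2) by auto
    moreover have "\<bar>t - (a + tau / 2)\<bar> \<le> tau / 2"
      using x(3,4) unfolding abs_le_iff by (simp add: field_simps)
    ultimately show "x \<noteq> 0 \<and> (\<exists>\<theta>. \<bar>\<theta>\<bar> \<le> tau / 2 \<and> x = norm x *\<^sub>R unit_dir ((a + tau / 2) + \<theta>))"
      using x by (intro conjI exI[of _ "t - (a + tau / 2)"]) auto
  next
    fix r \<theta> :: real assume "0 < r" "\<bar>\<theta>\<bar> < tau / 2"
    then have "unit_dir ((a + tau / 2) + \<theta>) \<in> unit_dir ` {a<..<a + tau}"
      by (intro imageI) auto
    with low \<open>0 < r\<close> show "r *\<^sub>R unit_dir ((a + tau / 2) + \<theta>) \<in> direction_cone D"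
      unfolding direction_cone_def by blast
  qed
qed

text \<open>The conditions of \<open>wide_cone\<close> with \<open>h = pi\<close> leave the ray
  opposite to the axis undecided; a half-open arc of length 2 pi does contain it.\<close>

lemma full_circle_cone:
  assumes "half_open_arc D (2 * pi)" "x \<noteq> 0"
  shows "x \<in> direction_cone D"
proof -
  obtain a where a: "D = unit_dir ` {a..<a + 2 * pi} \<or> D = unit_dir ` {a<..a + 2 * pi}"
    using assms unfolding half_open_arc_def by blast
  obtain \<theta> where \<theta>: "a \<le> \<theta>" "\<theta> < a + 2 * pi" "x = norm x *\<^sub>R unit_dir \<theta>"
    using polar_form[of a x] .
  have "unit_dir \<theta> \<in> D"
    using a
  proof
    assume "D = unit_dir ` {a<..a + 2 * pi}"
    moreover have "unit_dir \<theta> \<in> unit_dir ` {a<..a + 2 * pi}"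
    proof (cases "\<theta> = a")
      case True
      then show ?thesis
        using unit_dir_periodic[of a 1] by (intro image_eqI[of _ _ "a + 2 * pi"]) auto
    qed (use \<theta> in auto)
    ultimately show ?thesis
      by simp
  qed (use \<theta> in auto)
  with \<theta>(3) assms(2) show ?thesis
    unfolding direction_cone_def by (metis (mono_tags, lifting) mem_Collect_eq zero_less_norm_iff)
qed

text \<open>A nonzero lattice vector or its negative is a competitor at time 0, and only finitely
  many vectors in the window are no longer, so the infimum is a minimum.\<close>

lemma nn_dist_attained:
  assumes L: "unimodular_lattice L"
    and cone: "\<And>x. x \<noteq> 0 \<Longrightarrow> x \<in> direction_cone D \<or> - x \<in> direction_cone D"
    and n: "1 \<le> n" "n \<le> N"
  obtains t x where "shifted_lattice \<alpha> L t x" "x \<in> direction_cone D"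
    "1 - int n \<le> t" "t \<le> int N - int n" "norm x = nn_dist D \<alpha> L N n"
    "\<And>s y. shifted_lattice \<alpha> L s y \<Longrightarrow> y \<in> direction_cone D \<Longrightarrow> 1 - int n \<le> s \<Longrightarrow>
      s \<le> int N - int n \<Longrightarrow> nn_dist D \<alpha> L N n \<le> norm y"
proof -
  define V where "V = {x \<in> direction_cone D. \<exists>t. 1 - int n \<le> t \<and> t \<le> int N - int n \<and> shifted_lattice \<alpha> L t x}"
  have nn: "nn_dist D \<alpha> L N n = Inf (norm ` V)"
    unfolding nn_dist_eq V_def by (rule arg_cong[of _ _ Inf]) auto
  obtain b where b: "b \<in> L" "b \<noteq> 0"
    using unimodular_lattice_nonzero[OF L] by blast
  have "0 - b \<in> L"
    using unimodular_lattice_diff[OF L unimodular_lattice_diff[OF L b(1) b(1)] b(1)] by simp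
  then have "b \<in> V \<or> - b \<in> V"
    using cone[OF b(2)] b(1) n unfolding V_def shifted_lattice_def by (auto intro!: exI[of _ 0])
  then obtain v where v: "v \<in> V"
    by blast
  define W where "W = {x \<in> V. norm x \<le> norm v}"
  have "finite W"
  proof (rule finite_subset)
    let ?B = "\<lambda>t. {l \<in> L. norm l \<le> norm v + norm (of_int t *\<^sub>R \<alpha>)}"
    show "W \<subseteq> (\<Union>t\<in>{1 - int n..int N - int n}. (\<lambda>l. of_int t *\<^sub>R \<alpha> + l) ` ?B t)"
    proof
      fix x assume "x \<in> W"
      then obtain t where t: "1 - int n \<le> t" "t \<le> int N - int n" "x - of_int t *\<^sub>R \<alpha> \<in> L" "norm x \<le> norm v"
        unfolding W_def V_def shifted_lattice_def by blast
      then have "x - of_int t *\<^sub>R \<alpha> \<in> ?B t"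
        using norm_triangle_ineq4[of x "of_int t *\<^sub>R \<alpha>"] by simp
      then have "x \<in> (\<lambda>l. of_int t *\<^sub>R \<alpha> + l) ` ?B t"
        by (rule image_eqI[rotated]) simp
      with t(1,2) show "x \<in> (\<Union>t\<in>{1 - int n..int N - int n}. (\<lambda>l. of_int t *\<^sub>R \<alpha> + l) ` ?B t)"
        by auto
    qed
    show "finite (\<Union>t\<in>{1 - int n..int N - int n}. (\<lambda>l. of_int t *\<^sub>R \<alpha> + l) ` ?B t)"
      using unimodular_lattice_finite_ball[OF L] by auto
  qed
  moreover have "v \<in> W"
    using v by (simp add: W_def)
  ultimately obtain x where x: "x \<in> W" "\<And>y. y \<in> W \<Longrightarrow> norm x \<le> norm y"
    by (metis arg_min_least arg_min_if_finite(1) empty_iff)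
  have least: "norm x \<le> norm y" if "y \<in> V" for y
    using x(2)[of y] x(2)[OF \<open>v \<in> W\<close>] that unfolding W_def by fastforce
  have "x \<in> V"
    using x(1) by (simp add: W_def)
  then have eq: "norm x = nn_dist D \<alpha> L N n"
    unfolding nn using least by (intro cInf_eq_minimum[symmetric]) auto
  from \<open>x \<in> V\<close> obtain t where "1 - int n \<le> t" "t \<le> int N - int n" "shifted_lattice \<alpha> L t x" "x \<in> direction_cone D"
    unfolding V_def by blast
  then show thesis
    using that[of t x] eq least unfolding V_def by auto
qed

section \<open>The rows of the bound and the conclusion\<close>

lemma gap_bound_small:
  assumes "pi < tau" "tau < 4 * pi / 3"
  shows "gap_bound tau = 12 + 2 * \<lfloor>sin (tau / 2 + pi / 6) / sin (tau - pi)\<rfloor>"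
  using assms by (auto simp: gap_bound_def)

text \<open>Every row in this range is 8 or 9, so one uniform estimate by 8 serves all of
  them.\<close>

lemma gap_bound_large:
  assumes "4 * pi / 3 \<le> tau" "tau < 2 * pi"
  shows "8 \<le> gap_bound tau"
  using assms by (auto simp: gap_bound_def)

text \<open>Serves the case \<open>N = 0\<close>, where the set of values is empty.\<close>

lemma gap_bound_nonneg:
  assumes "pi < tau" "tau \<le> 2 * pi"
  shows "0 \<le> gap_bound tau"
proof -
  consider "tau = 2 * pi" | "4 * pi / 3 \<le> tau" "tau < 2 * pi" | "tau < 4 * pi / 3"
    using assms by linarith
  then show ?thesis
  proof cases
    case 3
    have "0 < sin (tau / 2 + pi / 6)" "0 < sin (tau - pi)"
      using assms 3 by (intro sin_gt_zero; simp)+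
    then have "0 \<le> sin (tau / 2 + pi / 6) / sin (tau - pi)"
      by (intro divide_nonneg_pos less_imp_le)
    then show ?thesis
      unfolding gap_bound_small[OF assms(1) 3] by simp
  qed (use gap_bound_large[of tau] in \<open>auto simp: gap_bound_def\<close>)
qed

theorem theorem1p4:
  fixes D L :: "(real^2) set" and \<alpha> :: "real^2" and tau :: real and N :: nat
  assumes "half_open_arc D tau" and "pi < tau"
    and "unimodular_lattice L"
  shows "int (gN N D \<alpha> L) \<le> gap_bound tau"
proof (cases "N = 0")
  case True
  then show ?thesis
    using gap_bound_nonneg[of tau] assms by (simp add: gN_def half_open_arc_def)
next
  case False
  define M where "M = int N - 1"
  define \<delta> where "\<delta> = (\<lambda>a. nn_dist D \<alpha> L N (nat (a + 1)))"
  have tau: "tau \<le> 2 * pi"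
    using assms(1) by (simp add: half_open_arc_def)
  obtain \<gamma> where \<gamma>: "\<And>x. x \<in> direction_cone D \<Longrightarrow>
      x \<noteq> 0 \<and> (\<exists>\<theta>. \<bar>\<theta>\<bar> \<le> tau / 2 \<and> x = norm x *\<^sub>R unit_dir (\<gamma> + \<theta>))"
    "\<And>r \<theta>. 0 < r \<Longrightarrow> \<bar>\<theta>\<bar> < tau / 2 \<Longrightarrow> r *\<^sub>R unit_dir (\<gamma> + \<theta>) \<in> direction_cone D"
    using half_open_arc_cone[OF assms(1)] by blast
  interpret wide_cone "direction_cone D" \<gamma> "tau / 2"
    using \<gamma> assms(2) tau by unfold_locales auto
  interpret direction_gaps "direction_cone D" \<gamma> "tau / 2" "shifted_lattice \<alpha> L" M \<delta>
  proof unfold_locales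
    show "shifted_lattice \<alpha> L (s - t) (x - y)" if "shifted_lattice \<alpha> L s x" "shifted_lattice \<alpha> L t y" for s t x y
      using unimodular_lattice_diff[OF assms(3) that[unfolded shifted_lattice_def]]
      by (simp add: shifted_lattice_def algebra_simps)
    fix a assume a: "0 \<le> a" "a \<le> M"
    then have n: "1 \<le> nat (a + 1)" "nat (a + 1) \<le> N"
      by (simp_all add: M_def)
    have shift: "1 - int (nat (a + 1)) = - a" "int N - int (nat (a + 1)) = M - a"
      using a by (simp_all add: M_def)
    note min = nn_dist_attained[OF assms(3) in_C_or_minus n, where \<alpha> = \<alpha>, unfolded shift, folded \<delta>_def]
    show "\<exists>t x. shifted_lattice \<alpha> L t x \<and> x \<in> direction_cone D \<and> - a \<le> t \<and> t \<le> M - a \<and> norm x = \<delta> a"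
      unfolding \<delta>_def by (rule min) blast+
    show "\<delta> a \<le> norm x"
      if "shifted_lattice \<alpha> L t x" "x \<in> direction_cone D" "- a \<le> t" "t \<le> M - a" for t x
      unfolding \<delta>_def by (rule min) (use that in blast)+
  qed
  have "(\<lambda>n. nn_dist D \<alpha> L N n) ` {1..N} = \<delta> ` {0..M}"
  proof -
    have "{1..N} = (\<lambda>a. nat (a + 1)) ` {0..M}"
    proof
      show "{1..N} \<subseteq> (\<lambda>a. nat (a + 1)) ` {0..M}"
      proof
        fix n assume "n \<in> {1..N}"
        then show "n \<in> (\<lambda>a. nat (a + 1)) ` {0..M}"
          by (intro image_eqI[of _ _ "int n - 1"]) (auto simp: M_def)
      qed
    qed (auto simp: M_def)
    then show ?thesis
      by (simp add: \<delta>_def image_image)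
  qed
  then have card: "gN N D \<alpha> L = card (\<delta> ` {0..M})"
    by (simp add: gN_def)
  obtain T' \<delta>' A where P: "peak_window (direction_cone D) \<gamma> (tau / 2) T' M \<delta>' A"
    and eq: "\<delta>' ` {0..M} = \<delta> ` {0..M}"
    using peak_window_exists False by (auto simp: M_def)
  interpret P: peak_window "direction_cone D" \<gamma> "tau / 2" T' M \<delta>' A
    by (rule P)
  consider "tau = 2 * pi" | "4 * pi / 3 \<le> tau" "tau < 2 * pi" | "tau < 4 * pi / 3"
    using tau by linarith
  then show ?thesis
  proof cases
    case 1
    then have "card (\<delta> ` {0..M}) \<le> 5"
      using P.card_values_full full_circle_cone assms(1) eq by auto
    with 1 show ?thesis
      by (simp add: card gap_bound_def)
  next
    case 2
    then have "card (\<delta> ` {0..M}) \<le> 8"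
      using P.card_values_narrow eq by auto
    with gap_bound_large[OF 2] show ?thesis
      by (simp add: card)
  next
    case 3
    then have "int (card (\<delta> ` {0..M})) \<le> 11 + 2 * \<lfloor>sin (tau / 2 + pi / 6) / sin (tau - pi)\<rfloor>"
      using P.card_values_wide eq by auto
    \<comment> \<open>The count obtained, with 11 in place of 12, is one below the stated
      bound.\<close>
    then show ?thesis
      unfolding card gap_bound_small[OF assms(2) 3] by linarith
  qed
qed

end
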